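(* Consider the zeroth-order algorithm described in the context, with $n$ agents, local costs $f_1,\dots,f_n:\mathbb{R}^d\to\mathbb{R}$, and $f=\frac1n\sum_{i=1}^n f_i$. Assume: (1) $f^*:=\inf_{x\in\mathbb{R}^d} f(x)>-\infty$ and there are constants $G,L$ such that for every $i\in[n]$, $f_i$ is $G$-Lipschitz and $L$-smooth, i.e. $|f_i(x)-f_i(y)|\le G\|x-y\|$ and $\|\nabla f_i(x)-\nabla f_i(y)\|\le L\|x-y\|$ for all $x,y\in\mathbb{R}^d$; (2) there is a constant non-negative integer $B$ such that $0\le t-\tau_j^i(t)\le B$ for all $i,j\in[n]$ and all $t\ge 0$; (3) $\eta(t)=\frac{\eta_0}{(t+1)^\alpha}$ and $u(t)=\frac{u_0}{(t+1)^\beta}$ with $\eta_0>0$, $u_0>0$, $0<\alpha<1$, $\beta>0$. Then $$\lim_{T\to\infty}\frac{1}{T+1}\sum_{t=0}^{T}\mathbb{E}\left[\|\nabla f(x(t))\|^2\right]=0.$$ In particular, if $\alpha=\frac12$ and $\beta=\frac14$, then for any $0<\varepsilon<\frac12$, $$\frac{1}{T+1}\sum_{t=0}^{T}\mathbb{E}\left[\|\nabla f(x(t))\|^2\right]=\mathcal{O}\left(T^{-(\frac12-\varepsilon)}\right)\quad\text{as } T\to\infty.$$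
   Context: Notation: $[n]=\{1,\dots,n\}$; $\|\cdot\|$ is the Euclidean norm; $d=d_1+\dots+d_n$ and $\mathbb{R}^d=\mathbb{R}^{d_1}\times\cdots\times\mathbb{R}^{d_n}$, so $x\in\mathbb{R}^d$ is written $x=(x^1,\dots,x^n)$ with $x^i\in\mathbb{R}^{d_i}$ the block controlled by agent $i$. Algorithm. The initial point $x(0)=(x^1_0,\dots,x^n_0)\in\mathbb{R}^d$ is arbitrary. At each time $t=0,1,2,\dots$, each agent $i$ draws $z^i(t)\sim\mathcal{N}(0,I_{d_i})$; all the vectors $z^i(t)$ ($i\in[n]$, $t\ge0$) are independent, and $z(t)=(z^1(t),\dots,z^n(t))$. With step-size $\eta(t)>0$ and smoothing radius $u(t)>0$, each agent $i$ computes $$D_i(t)=\frac{f_i(x(t)+u(t)z(t))-f_i(x(t)-u(t)z(t))}{2u(t)}$$ and sends it out. For $i,j\in[n]$, the integer $\tau_j^i(t)\le t$ is the latest time $s$ such that $D_j(s)$ has been received by agent $i$ by time $t$ (nondecreasing in $t$), with $\tau_j^i(t)=-1$ if agent $i$ has received nothing from $j$ by time $t$, and $\tau_i^i(t)=t$. The times $\tau_j^i(t)$ are deterministic (not dependent on the random vectors). Agent $i$ forms $$g^i(t)=\frac1n\sum_{j:\,\tau_j^i(t)\ge0}D_j(\tau_j^i(t))\,z^i(\tau_j^i(t))$$ and updates $x^i(t+1)=x^i(t)-\eta(t)g^i(t)$. Expectations are over all the random vectors. The constant in $\mathcal{O}(\cdot)$ may depend on all problem parameters and on $\varepsilon$,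 but not on $T$. *)

theory Defs
  imports "HOL-Probability.Probability"
begin

text \<open>
  The agents are the elements of a finite type \<open>'n\<close>, and the scalar coordinates of the joint
  decision space are the elements of a finite type \<open>'d\<close>, so that the space is \<open>real ^ 'd\<close> with its
  Euclidean norm.  A map \<open>own :: 'd \<Rightarrow> 'n\<close> assigns each coordinate to the agent controlling it:
  the block of agent \<open>i\<close> consists of the coordinates \<open>k\<close> with \<open>own k = i\<close>, whose number is the
  block dimension of \<open>i\<close>.  Every decomposition into blocks of arbitrary (possibly different)
  dimensions arises in this way.
\<close>

definition block :: "('d \<Rightarrow> 'n) \<Rightarrow> 'n \<Rightarrow> real ^ 'd \<Rightarrow> ('d \<Rightarrow> real)" where
  "block own i v = (\<lambda>k\<in>{k. own k = i}. v $ k)"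

text \<open>The standard Gaussian law (zero mean, identity covariance) on the functions \<open>K \<rightarrow> \<real>\<close>.\<close>

definition std_gaussian :: "'d set \<Rightarrow> ('d \<Rightarrow> real) measure" where
  "std_gaussian K = PiM K (\<lambda>_. density lborel (\<lambda>r. ennreal (std_normal_density r)))"

definition grad :: "('a::real_inner \<Rightarrow> real) \<Rightarrow> 'a \<Rightarrow> 'a" where
  "grad f x = (THE D. GDERIV f x :> D)"

definition lsmooth :: "real \<Rightarrow> ('a::real_inner \<Rightarrow> real) \<Rightarrow> bool" where
  "lsmooth L f \<longleftrightarrow> (\<forall>x. f differentiable (at x)) \<and> L-lipschitz_on UNIV (grad f)"

definition avg_cost :: "('n::finite \<Rightarrow> 'a \<Rightarrow> real) \<Rightarrow> 'a \<Rightarrow> real" where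
  "avg_cost f x = (1 / real CARD('n)) * (\<Sum>i\<in>UNIV. f i x)"

definition two_point_diff :: "('a::real_vector \<Rightarrow> real) \<Rightarrow> real \<Rightarrow> 'a \<Rightarrow> 'a \<Rightarrow> real" where
  "two_point_diff h u x z = (h (x + u *\<^sub>R z) - h (x - u *\<^sub>R z)) / (2 * u)"

text \<open>
  \<open>\<tau> i j t\<close> is the time stamp of the latest value of agent \<open>j\<close> available to agent \<open>i\<close> at time \<open>t\<close>,
  or \<open>-1\<close> if there is none.  The vector below collects the estimates of all agents at time \<open>t\<close>: its
  block \<open>i\<close> is the estimate formed by agent \<open>i\<close> from the difference quotients \<open>D j s\<close> of
  the agents \<open>j\<close> at times \<open>s\<close> and from its own past random blocks.
\<close>

definition grad_estimate ::
    "('d::finite \<Rightarrow> 'n::finite) \<Rightarrow> ('n \<Rightarrow> 'n \<Rightarrow> nat \<Rightarrow> int) \<Rightarrow> ('n \<Rightarrow> nat \<Rightarrow> real) \<Rightarrow>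
     (nat \<Rightarrow> real ^ 'd) \<Rightarrow> nat \<Rightarrow> real ^ 'd" where
  "grad_estimate own \<tau> D z t =
     (\<chi> k. (1 / real CARD('n)) *
        (\<Sum>j | \<tau> (own k) j t \<ge> 0. D j (nat (\<tau> (own k) j t)) * z (nat (\<tau> (own k) j t)) $ k))"

end

theory Submission
  imports Defs
begin

text \<open>
  Write \<open>F\<close> for the average cost and \<open>g(t)\<close> for the joint estimate, so that
  \<open>x(t+1) = x(t) - \<eta>(t) g(t)\<close>.  Smoothness of \<open>F\<close> gives
  \<open>F(x(t+1)) \<le> F(x(t)) - \<eta>(t) \<langle>\<nabla>F(x(t)), g(t)\<rangle> + L \<eta>(t)\<^sup>2 \<parallel>g(t)\<parallel>\<^sup>2\<close>, so everything hinges on a lower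
  bound for the expected alignment \<open>E \<langle>\<nabla>F(x(t)), g(t)\<rangle>\<close>.

  The alignment is a sum over coordinates \<open>k\<close> and agents \<open>j\<close> of the terms
  \<open>\<partial>\<^sub>kF(x(t)) D\<^sub>j(s) z\<^sub>k(s)\<close>, where \<open>s\<close> is the stale time stamp used by the owner of \<open>k\<close>.  In such a
  term the point \<open>x(t)\<close> depends on the direction \<open>z(s)\<close>, but \<open>x(s)\<close> does not: it is a function of
  directions drawn strictly before \<open>s\<close>.  Since \<open>t - s \<le> B\<close>, moving from \<open>x(t)\<close> to \<open>x(s)\<close> costs only
  the length of at most \<open>B\<close> steps, that is, a multiple of the step sizes in the window.  At \<open>x(s)\<close>
  the difference quotient is \<open>\<langle>\<nabla>f\<^sub>j(x(s)), z(s)\<rangle>\<close> up to an error of size \<open>L u(s) \<parallel>z(s)\<parallel>\<^sup>2\<close>, and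
  independence together with \<open>E z\<^sub>l z\<^sub>k = \<delta>\<^sub>l\<^sub>k\<close> turns the main part into
  \<open>E \<partial>\<^sub>kF(x(s)) \<partial>\<^sub>kf\<^sub>j(x(s))\<close>; moving back to \<open>x(t)\<close> costs again one multiple of the step sizes, and
  averaging over \<open>j\<close> gives \<open>E (\<partial>\<^sub>kF(x(t)))\<^sup>2\<close>.  The smoothing error is absorbed by Young's inequality
  into half of that square, which leaves an error proportional to \<open>u(s)\<^sup>2\<close> rather than \<open>u(s)\<close>; this
  is what makes \<open>\<beta> = 1/4\<close> good enough for the rate close to \<open>1/2\<close>.

  The outcome (\<open>expected_descent\<close>) is
  \<open>\<eta>(t) E \<parallel>\<nabla>F(x(t))\<parallel>\<^sup>2 \<le> 2 E (F(x(t)) - F(x(t+1))) + O(\<eta>(t) \<Sum>\<^sub>q (\<eta>(q) + u(q)\<^sup>2))\<close> with \<open>q\<close> in the window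
  \<open>t - B, \<dots>, t\<close>.  What remains is deterministic (\<open>average_rate_of_descent\<close>): after division by
  \<open>\<eta>(t)\<close>, summation by parts bounds the averages of \<open>E \<parallel>\<nabla>F(x(t))\<parallel>\<^sup>2\<close> by a multiple of \<open>(T+1)\<^sup>-\<^sup>\<gamma>\<close> for
  every \<open>\<gamma>\<close> with \<open>0 < \<gamma> \<le> min \<alpha> (2\<beta>)\<close> and \<open>\<gamma> < 1 - \<alpha>\<close>.  Some such \<open>\<gamma>\<close> always exists, which is the
  convergence claim, and \<open>\<alpha> = 1/2\<close>, \<open>\<beta> = 1/4\<close> allow every \<open>\<gamma> < 1/2\<close>.
\<close>

section \<open>Gradients of smooth Lipschitz functions\<close>

lemma GDERIV_unique:
  assumes "GDERIV f x :> D" "GDERIV f x :> D'" shows "D = D'"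
proof -
  have "(\<lambda>h. inner h D) = (\<lambda>h. inner h D')"
    using assms unfolding gderiv_def by (rule has_derivative_unique)
  then have "inner (D - D') D = inner (D - D') D'" by metis
  then have "inner (D - D') (D - D') = 0" by (simp add: inner_diff_right)
  then show ?thesis by simp
qed

lemma grad_eqI: "GDERIV f x :> D \<Longrightarrow> grad f x = D"
  unfolding grad_def by (blast intro: the_equality GDERIV_unique)

text \<open>
  In a Euclidean space a derivative is a linear functional, hence an inner product with the vector
  of its values on an orthonormal basis; so the description in the definition of \<open>grad\<close> denotes.
\<close>

lemma GDERIV_grad:
  fixes f :: "'a::euclidean_space \<Rightarrow> real"
  assumes "f differentiable (at x)"
  shows "GDERIV f x :> grad f x"
proof -
  obtain f' where f': "(f has_derivative f') (at x)"
    using assms unfolding differentiable_def by blast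
  then interpret f': bounded_linear f' by (rule has_derivative_bounded_linear)
  have "f' = (\<lambda>h. inner h (\<Sum>b\<in>Basis. f' b *\<^sub>R b))"
  proof
    fix h
    have "f' h = f' (\<Sum>b\<in>Basis. inner h b *\<^sub>R b)" by (simp add: euclidean_representation)
    also have "\<dots> = (\<Sum>b\<in>Basis. inner h b * f' b)" by (simp add: f'.sum f'.scale)
    also have "\<dots> = inner h (\<Sum>b\<in>Basis. f' b *\<^sub>R b)"
      by (simp add: inner_sum_right mult.commute)
    finally show "f' h = inner h (\<Sum>b\<in>Basis. f' b *\<^sub>R b)" .
  qed
  with f' have "GDERIV f x :> (\<Sum>b\<in>Basis. f' b *\<^sub>R b)" by (simp add: gderiv_def)
  then show ?thesis using grad_eqI by metis
qed

lemma GDERIV_along_line: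
  assumes "GDERIV f (x + s *\<^sub>R v) :> D"
  shows "((\<lambda>s. f (x + s *\<^sub>R v)) has_real_derivative inner v D) (at s within S)"
proof -
  have "((\<lambda>s. x + s *\<^sub>R v) has_derivative (\<lambda>h. h *\<^sub>R v)) (at s within S)"
    by (auto intro!: derivative_eq_intros)
  from has_derivative_compose[OF this assms[unfolded gderiv_def]]
  show ?thesis by (simp add: has_field_derivative_def mult_commute_abs)
qed

text \<open>
  Along the direction of the gradient \<open>g\<close> itself, the derivative is \<open>\<parallel>g\<parallel>\<^sup>2\<close> while the difference
  quotients are at most \<open>G \<parallel>g\<parallel>\<close>.
\<close>

lemma norm_grad_le_lipschitz:
  fixes f :: "'a::euclidean_space \<Rightarrow> real"
  assumes diff: "f differentiable (at x)" and lip: "G-lipschitz_on UNIV f"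
  shows "norm (grad f x) \<le> G"
proof -
  let ?g = "grad f x"
  have "((\<lambda>s. f (x + s *\<^sub>R ?g)) has_real_derivative inner ?g ?g) (at 0)"
    by (rule GDERIV_along_line) (simp add: GDERIV_grad[OF diff])
  then have lim: "((\<lambda>h. (f (x + h *\<^sub>R ?g) - f x) / h) \<longlongrightarrow> inner ?g ?g) (at 0)"
    by (simp add: DERIV_def)
  have "(f (x + h *\<^sub>R ?g) - f x) / h \<le> G * norm ?g" for h
  proof -
    have "\<bar>f (x + h *\<^sub>R ?g) - f x\<bar> \<le> G * (\<bar>h\<bar> * norm ?g)"
      using lipschitz_onD[OF lip, of "x + h *\<^sub>R ?g" x] by (simp add: dist_norm)
    then have "\<bar>(f (x + h *\<^sub>R ?g) - f x) / h\<bar> \<le> G * norm ?g" if "h \<noteq> 0"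
      using that by (simp add: abs_divide divide_le_eq mult_ac)
    then show ?thesis using lipschitz_on_nonneg[OF lip] by (cases "h = 0") (simp, linarith)
  qed
  then have "inner ?g ?g \<le> G * norm ?g"
    by (intro tendsto_upperbound[OF lim]) (auto intro: always_eventually)
  then have "norm ?g * norm ?g \<le> G * norm ?g" by (simp add: dot_square_norm power2_eq_square)
  then show ?thesis
    using lipschitz_on_nonneg[OF lip] by (cases "norm ?g = 0") (auto simp: mult_le_cancel_right)
qed

text \<open>
  The mean value theorem puts the error in the form \<open>\<langle>\<nabla>f(\<xi>) - \<nabla>f(x), y - x\<rangle>\<close> with \<open>\<xi>\<close> on the
  segment.  Bounding this one difference instead of integrating along the segment yields \<open>L\<close> in
  place of \<open>L/2\<close>.
\<close>

lemma lsmooth_first_order: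
  fixes f :: "'a::euclidean_space \<Rightarrow> real"
  assumes "lsmooth L f"
  shows "\<bar>f y - f x - inner (grad f x) (y - x)\<bar> \<le> L * (norm (y - x))\<^sup>2"
proof -
  let ?v = "y - x"
  have diff: "\<And>x. f differentiable (at x)" and lip: "L-lipschitz_on UNIV (grad f)"
    using assms by (auto simp: lsmooth_def)
  have "\<exists>s\<in>{0..1::real}. f (x + 1 *\<^sub>R ?v) - f (x + 0 *\<^sub>R ?v)
          = (1 - 0) * inner ?v (grad f (x + s *\<^sub>R ?v))"
    by (rule mvt_very_simple[where f' = "\<lambda>s h. h * inner ?v (grad f (x + s *\<^sub>R ?v))"])
       (use GDERIV_along_line[OF GDERIV_grad[OF diff]] in
         \<open>auto simp: has_field_derivative_def mult_commute_abs\<close>)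
  then obtain s :: real where s: "0 \<le> s" "s \<le> 1"
    and eq: "f y - f x = inner ?v (grad f (x + s *\<^sub>R ?v))" by auto
  have "\<bar>f y - f x - inner (grad f x) ?v\<bar> = \<bar>inner ?v (grad f (x + s *\<^sub>R ?v) - grad f x)\<bar>"
    by (simp add: eq inner_diff_right inner_commute)
  also have "\<dots> \<le> norm ?v * norm (grad f (x + s *\<^sub>R ?v) - grad f x)"
    by (rule Cauchy_Schwarz_ineq2)
  also have "\<dots> \<le> norm ?v * (L * (s * norm ?v))"
    using lipschitz_onD[OF lip, of "x + s *\<^sub>R ?v" x] s
    by (intro mult_left_mono) (auto simp: dist_norm)
  also have "\<dots> \<le> norm ?v * (L * (1 * norm ?v))"
    using s lipschitz_on_nonneg[OF lip] by (intro mult_left_mono mult_right_mono) auto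
  finally show ?thesis by (simp add: power2_eq_square mult_ac)
qed

text \<open>
  The smoothing bias.  The values at \<open>x\<close> cancel in the symmetric difference, and the two first-order
  errors of size \<open>L u\<^sup>2 \<parallel>z\<parallel>\<^sup>2\<close> are divided by \<open>2 u\<close>.
\<close>

lemma two_point_diff_first_order:
  fixes f :: "'a::euclidean_space \<Rightarrow> real"
  assumes "lsmooth L f" "u > 0"
  shows "\<bar>two_point_diff f u x z - inner (grad f x) z\<bar> \<le> L * u * (norm z)\<^sup>2"
proof -
  let ?g = "inner (grad f x) z"
  have "\<bar>f (x + u *\<^sub>R z) - f x - u * ?g\<bar> \<le> L * (u\<^sup>2 * (norm z)\<^sup>2)"
    using lsmooth_first_order[OF assms(1), of "x + u *\<^sub>R z" x] by (simp add: power_mult_distrib)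
  moreover have "\<bar>f (x - u *\<^sub>R z) - f x + u * ?g\<bar> \<le> L * (u\<^sup>2 * (norm z)\<^sup>2)"
    using lsmooth_first_order[OF assms(1), of "x - u *\<^sub>R z" x] by (simp add: power_mult_distrib)
  ultimately have "\<bar>f (x + u *\<^sub>R z) - f (x - u *\<^sub>R z) - 2 * u * ?g\<bar> \<le> 2 * L * (u\<^sup>2 * (norm z)\<^sup>2)"
    by linarith
  moreover have "2 * u * two_point_diff f u x z = f (x + u *\<^sub>R z) - f (x - u *\<^sub>R z)"
    using assms(2) by (simp add: two_point_diff_def)
  ultimately have "\<bar>2 * u * (two_point_diff f u x z - ?g)\<bar> \<le> 2 * u * (L * u * (norm z)\<^sup>2)"
    by (simp add: right_diff_distrib power2_eq_square mult_ac)
  then show ?thesis using assms(2) by (simp add: abs_mult)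
qed

lemma two_point_diff_bound:
  fixes f :: "'a::real_normed_vector \<Rightarrow> real"
  assumes "G-lipschitz_on UNIV f" "u > 0"
  shows "\<bar>two_point_diff f u x z\<bar> \<le> G * norm z"
proof -
  have eq: "(x + u *\<^sub>R z) - (x - u *\<^sub>R z) = (2 * u) *\<^sub>R z"
    by (simp add: scaleR_add_left[symmetric])
  have "\<bar>f (x + u *\<^sub>R z) - f (x - u *\<^sub>R z)\<bar> \<le> G * norm ((2 * u) *\<^sub>R z)"
    using lipschitz_onD[OF assms(1), of "x + u *\<^sub>R z" "x - u *\<^sub>R z"]
    unfolding dist_norm eq by simp
  then show ?thesis
    using assms(2) by (simp add: two_point_diff_def divide_le_eq mult_ac)
qed

lemma grad_avg_cost:
  fixes f :: "'n::finite \<Rightarrow> 'a::euclidean_space \<Rightarrow> real"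
  assumes "\<And>i. f i differentiable (at x)"
  shows "GDERIV (avg_cost f) x :> (1 / real CARD('n)) *\<^sub>R (\<Sum>i\<in>UNIV. grad (f i) x)"
proof -
  have "((\<lambda>x. (1 / real CARD('n)) * (\<Sum>i\<in>UNIV. f i x)) has_derivative
          (\<lambda>h. (1 / real CARD('n)) * (\<Sum>i\<in>UNIV. inner h (grad (f i) x)))) (at x)"
    using GDERIV_grad[OF assms]
    by (intro has_derivative_mult_right has_derivative_sum) (auto simp: gderiv_def)
  then show ?thesis
    by (simp add: gderiv_def avg_cost_def[abs_def] inner_sum_right)
qed

lemma norm_average_le:
  fixes v :: "'n::finite \<Rightarrow> 'a::real_normed_vector"
  assumes "\<And>i. norm (v i) \<le> c"
  shows "norm ((1 / real CARD('n)) *\<^sub>R (\<Sum>i\<in>UNIV. v i)) \<le> c"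
proof -
  have "norm (\<Sum>i\<in>UNIV. v i) \<le> real CARD('n) * c"
    using sum_norm_bound[of UNIV v c] assms by simp
  then show ?thesis by (simp add: divide_le_eq mult.commute)
qed

lemma lipschitz_average:
  fixes g :: "'n::finite \<Rightarrow> 'a::metric_space \<Rightarrow> 'b::real_normed_vector"
  assumes "\<And>i. C-lipschitz_on UNIV (g i)"
  shows "C-lipschitz_on UNIV (\<lambda>x. (1 / real CARD('n)) *\<^sub>R (\<Sum>i\<in>UNIV. g i x))"
proof (rule lipschitz_onI)
  fix x y
  have "norm ((1 / real CARD('n)) *\<^sub>R (\<Sum>i\<in>UNIV. g i x - g i y)) \<le> C * dist x y"
    using lipschitz_onD[OF assms, of x y] by (intro norm_average_le) (simp add: dist_norm)
  then show "dist ((1 / real CARD('n)) *\<^sub>R (\<Sum>i\<in>UNIV. g i x))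
                  ((1 / real CARD('n)) *\<^sub>R (\<Sum>i\<in>UNIV. g i y)) \<le> C * dist x y"
    by (simp add: dist_norm sum_subtractf scaleR_diff_right)
qed (use assms lipschitz_on_nonneg in blast)

lemma lipschitz_avg_cost:
  "(\<And>i. G-lipschitz_on UNIV (f i)) \<Longrightarrow> G-lipschitz_on UNIV (avg_cost f)"
  using lipschitz_average[of G f] by (simp add: avg_cost_def[abs_def])

lemma lsmooth_avg_cost:
  fixes f :: "'n::finite \<Rightarrow> 'a::euclidean_space \<Rightarrow> real"
  assumes "\<And>i. lsmooth L (f i)"
  shows "lsmooth L (avg_cost f)"
proof -
  have d: "\<And>i x. f i differentiable (at x)" and l: "\<And>i. L-lipschitz_on UNIV (grad (f i))"
    using assms by (auto simp: lsmooth_def)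
  have "grad (avg_cost f) = (\<lambda>x. (1 / real CARD('n)) *\<^sub>R (\<Sum>i\<in>UNIV. grad (f i) x))"
    by (intro ext grad_eqI grad_avg_cost d)
  moreover have "avg_cost f differentiable (at x)" for x
    using grad_avg_cost[of f, OF d] unfolding gderiv_def differentiable_def by blast
  ultimately show ?thesis
    using lipschitz_average[OF l] by (simp add: lsmooth_def)
qed

section \<open>Moments of Gaussian blocks\<close>

lemma expectation_std_gaussian_prod:
  fixes K :: "'d::finite set"
  assumes "\<And>k. k \<in> K \<Longrightarrow> integrable lborel (\<lambda>r. std_normal_density r * g k r)"
    and g[measurable]: "\<And>k. g k \<in> borel_measurable borel"
  shows "integrable (std_gaussian K) (\<lambda>y. \<Prod>k\<in>K. g k (y k))" (is ?int)
    and "integral\<^sup>L (std_gaussian K) (\<lambda>y. \<Prod>k\<in>K. g k (y k))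
           = (\<Prod>k\<in>K. integral\<^sup>L lborel (\<lambda>r. std_normal_density r * g k r))" (is ?eq)
proof -
  let ?N = "density lborel (\<lambda>r. ennreal (std_normal_density r))"
  interpret prob_space ?N by (rule prob_space_normal_density) simp
  interpret product_sigma_finite "\<lambda>_. ?N" by standard
  have int: "integrable ?N (g k)" if "k \<in> K" for k
    using assms(1)[OF that] by (subst integrable_real_density) (auto simp: normal_density_nonneg)
  have eq: "integral\<^sup>L ?N (g k) = integral\<^sup>L lborel (\<lambda>r. std_normal_density r * g k r)" for k
    by (subst integral_real_density) (auto simp: normal_density_nonneg)
  show ?int unfolding std_gaussian_def by (rule product_integrable_prod) (auto intro: int)
  show ?eq unfolding std_gaussian_def eq[symmetric] by (rule product_integral_prod) (auto intro: int)
qed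

text \<open>
  Mixed moments of coordinates within one block factorize into one-dimensional Gaussian moments.
\<close>

lemma (in prob_space) gaussian_block_prod:
  fixes own :: "'d::finite \<Rightarrow> 'n" and z :: "'a \<Rightarrow> real ^ 'd" and K :: "'d set"
  assumes K: "K \<subseteq> {k. own k = i}"
    and meas: "(\<lambda>\<omega>. block own i (z \<omega>)) \<in> measurable M (PiM {k. own k = i} (\<lambda>_. borel))"
    and law: "distr M (PiM {k. own k = i} (\<lambda>_. borel)) (\<lambda>\<omega>. block own i (z \<omega>))
            = std_gaussian {k. own k = i}"
  shows "integrable M (\<lambda>\<omega>. \<Prod>k\<in>K. (z \<omega> $ k) ^ p k)"
    and "expectation (\<lambda>\<omega>. \<Prod>k\<in>K. (z \<omega> $ k) ^ p k)
         = (\<Prod>k\<in>K. integral\<^sup>L lborel (\<lambda>r. std_normal_density r * r ^ p k))"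
proof -
  let ?I = "{k. own k = i}" and ?P = "PiM {k. own k = i} (\<lambda>_. borel :: real measure)"
  \<comment> \<open>Coordinates outside \<open>K\<close> get exponent \<open>0\<close>, so that the product runs over the whole block.\<close>
  define q where "q k = (if k \<in> K then p k else 0)" for k
  let ?F = "\<lambda>y. \<Prod>k\<in>?I. (y k :: real) ^ q k"
  have F: "?F \<in> borel_measurable ?P" by measurable
  have comp: "(\<Prod>k\<in>K. (z \<omega> $ k) ^ p k) = ?F (block own i (z \<omega>))" for \<omega>
    unfolding q_def by (rule prod.mono_neutral_cong_left) (use K in \<open>auto simp: block_def\<close>)
  have int: "integrable lborel (\<lambda>r. std_normal_density r * r ^ q k)" for k
    by (rule integrable_std_normal_moment)
  note G = expectation_std_gaussian_prod[of ?I "\<lambda>k r. r ^ q k", OF int]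
  show "integrable M (\<lambda>\<omega>. \<Prod>k\<in>K. (z \<omega> $ k) ^ p k)"
    unfolding comp by (rule integrable_distr[OF meas]) (use G(1) in \<open>simp add: law\<close>)
  have "expectation (\<lambda>\<omega>. \<Prod>k\<in>K. (z \<omega> $ k) ^ p k) = integral\<^sup>L (std_gaussian ?I) ?F"
    unfolding comp law[symmetric] by (rule integral_distr[OF meas F, symmetric])
  also have "\<dots> = (\<Prod>k\<in>?I. integral\<^sup>L lborel (\<lambda>r. std_normal_density r * r ^ q k))"
    by (rule G(2)) measurable
  also have "\<dots> = (\<Prod>k\<in>K. integral\<^sup>L lborel (\<lambda>r. std_normal_density r * r ^ p k))"
    unfolding q_def by (rule prod.mono_neutral_cong_right) 
      (use K integral_std_normal_moment_even[of 0] in \<open>auto\<close>)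
  finally show "expectation (\<lambda>\<omega>. \<Prod>k\<in>K. (z \<omega> $ k) ^ p k)
         = (\<Prod>k\<in>K. integral\<^sup>L lborel (\<lambda>r. std_normal_density r * r ^ p k))" .
qed

lemma norm_vec_power_le:
  fixes v :: "real ^ 'd"
  shows "norm v ^ p \<le> real CARD('d) ^ p * (\<Sum>k\<in>UNIV. \<bar>v $ k\<bar> ^ p)"
proof -
  obtain m where m: "\<And>k. \<bar>v $ k\<bar> \<le> \<bar>v $ m\<bar>"
  proof -
    have "Max (range (\<lambda>k. \<bar>v $ k\<bar>)) \<in> range (\<lambda>k. \<bar>v $ k\<bar>)" by (rule Max_in) auto
    then obtain m where "Max (range (\<lambda>k. \<bar>v $ k\<bar>)) = \<bar>v $ m\<bar>" by (rule rangeE)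
    then show ?thesis using that[of m] Max_ge[of "range (\<lambda>k. \<bar>v $ k\<bar>)"] by auto
  qed
  have "norm v \<le> (\<Sum>k\<in>UNIV. \<bar>v $ k\<bar>)" by (rule norm_le_l1_cart)
  also have "\<dots> \<le> real CARD('d) * \<bar>v $ m\<bar>" using sum_bounded_above[of UNIV "\<lambda>k. \<bar>v $ k\<bar>"] m by simp
  finally have "norm v ^ p \<le> (real CARD('d) * \<bar>v $ m\<bar>) ^ p" by (intro power_mono) auto
  also have "\<dots> \<le> real CARD('d) ^ p * (\<Sum>k\<in>UNIV. \<bar>v $ k\<bar> ^ p)"
    unfolding power_mult_distrib by (intro mult_left_mono member_le_sum) auto
  finally show ?thesis .
qed

section \<open>Independent Gaussian directions\<close>

lemma borel_measurable_vecI: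
  fixes v :: "'a \<Rightarrow> real ^ 'd"
  assumes "\<And>k. (\<lambda>\<omega>. v \<omega> $ k) \<in> borel_measurable N"
  shows "v \<in> borel_measurable N"
proof (rule borel_measurable_euclidean_space[THEN iffD2], rule ballI)
  fix b :: "real ^ 'd" assume "b \<in> Basis"
  then obtain k where "b = axis k 1" unfolding Basis_vec_def by auto
  then show "(\<lambda>\<omega>. v \<omega> \<bullet> b) \<in> borel_measurable N" using assms[of k] by (simp add: inner_axis)
qed

lemma sets_vimage_algebra_measurable:
  "X \<in> measurable M S \<Longrightarrow> sets (vimage_algebra (space M) X S) = {X -` A \<inter> space M |A. A \<in> sets S}"
  by (rule sets_vimage_algebra2) (simp add: measurable_def)

lemma measurable_vimage_algebraD:
  assumes X: "X \<in> measurable M S" and f: "f \<in> measurable (vimage_algebra (space M) X S) R"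
  shows "f \<in> measurable M R"
    and "sigma_sets (space M) {f -` A \<inter> space M |A. A \<in> sets R}
           \<subseteq> sigma_sets (space M) {X -` A \<inter> space M |A. A \<in> sets S}"
proof -
  have "sets (vimage_algebra (space M) X S) \<subseteq> sets M"
    unfolding sets_vimage_algebra_measurable[OF X] using measurable_sets[OF X] by blast
  then have "measurable (vimage_algebra (space M) X S) R \<subseteq> measurable M R"
    by (intro measurable_mono) simp_all
  with f show "f \<in> measurable M R" by (rule rev_subsetD)
  have "f -` A \<inter> space M \<in> {X -` A \<inter> space M |A. A \<in> sets S}" if "A \<in> sets R" for A
    using measurable_sets[OF f that] by (simp add: sets_vimage_algebra_measurable[OF X])
  then have "{f -` A \<inter> space M |A. A \<in> sets R} \<subseteq> {X -` A \<inter> space M |A. A \<in> sets S}"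
    by blast
  then show "sigma_sets (space M) {f -` A \<inter> space M |A. A \<in> sets R}
          \<subseteq> sigma_sets (space M) {X -` A \<inter> space M |A. A \<in> sets S}"
    by (rule sigma_sets_mono')
qed

text \<open>
  Independence only concerns generated \<open>\<sigma>\<close>-algebras, so it passes to anything measurable with
  respect to them.  In this form no explicit expression of \<open>f\<close> as a function of \<open>X\<close> has to be
  exhibited, which suits iterates that are defined by recursion.
\<close>

lemma (in prob_space) indep_var_vimage_measurable:
  assumes ind: "indep_var S X T Y"
    and f: "f \<in> measurable (vimage_algebra (space M) X S) S'"
    and g: "g \<in> measurable (vimage_algebra (space M) Y T) T'"
  shows "indep_var S' f T' g"
proof -
  have X: "X \<in> measurable M S" and Y: "Y \<in> measurable M T"
    and sets: "indep_sets (case_bool (sigma_sets (space M) {X -` A \<inter> space M |A. A \<in> sets S})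
                 (sigma_sets (space M) {Y -` A \<inter> space M |A. A \<in> sets T})) UNIV"
    using ind by (simp_all add: indep_var_eq indep_set_def)
  note f = measurable_vimage_algebraD[OF X f] and g = measurable_vimage_algebraD[OF Y g]
  have "indep_sets (case_bool (sigma_sets (space M) {f -` A \<inter> space M |A. A \<in> sets S'})
          (sigma_sets (space M) {g -` A \<inter> space M |A. A \<in> sets T'})) UNIV"
    by (rule indep_sets_mono_sets[OF sets]) (use f(2) g(2) in \<open>auto split: bool.split\<close>)
  then show ?thesis using f(1) g(1) by (simp add: indep_var_eq indep_set_def)
qed

locale gaussian_blocks = prob_space M
  for M :: "'w measure" +
  fixes own :: "'d::finite \<Rightarrow> 'n::finite"
    and z :: "nat \<Rightarrow> 'w \<Rightarrow> real ^ 'd"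
  assumes z_normal: "distr M (PiM {k. own k = i} (\<lambda>_. borel)) (\<lambda>\<omega>. block own i (z t \<omega>))
                     = std_gaussian {k. own k = i}"
    and z_indep: "indep_vars (\<lambda>(i, t). PiM {k. own k = i} (\<lambda>_. borel))
                    (\<lambda>(i, t) \<omega>. block own i (z t \<omega>)) (UNIV :: ('n \<times> nat) set)"
begin

lemma block_measurable:
  "(\<lambda>\<omega>. block own i (z t \<omega>)) \<in> measurable M (PiM {k. own k = i} (\<lambda>_. borel))"
proof -
  have "random_variable ((\<lambda>(i, t). PiM {k. own k = i} (\<lambda>_. borel)) (i, t))
          ((\<lambda>(i, t) \<omega>. block own i (z t \<omega>)) (i, t))"
    using z_indep unfolding indep_vars_def by blast
  then show ?thesis by simp
qed

lemma z_component: "z t \<omega> $ k = block own (own k) (z t \<omega>) k"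
  by (simp add: block_def)

lemma z_measurable [measurable]: "z t \<in> borel_measurable M"
proof (rule borel_measurable_vecI)
  fix k show "(\<lambda>\<omega>. z t \<omega> $ k) \<in> borel_measurable M"
    unfolding z_component
    by (rule measurable_compose[OF block_measurable measurable_component_singleton]) simp
qed

text \<open>
  The blocks with index in \<open>P\<close> are bundled into one random element of a product space, because
  independence of disjoint subfamilies comes in the form of independence of such bundles.
\<close>

definition generated_by :: "('n \<times> nat) set \<Rightarrow> 'w measure" where
  "generated_by P = vimage_algebra (space M) (\<lambda>\<omega>. \<lambda>(i, t)\<in>P. block own i (z t \<omega>))
     (PiM P (\<lambda>(i, t). PiM {k. own k = i} (\<lambda>_. borel)))"

lemma space_generated_by [simp]: "space (generated_by P) = space M"
  by (simp add: generated_by_def)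

lemma z_component_generated_by:
  assumes "(own k, t) \<in> P"
  shows "(\<lambda>\<omega>. z t \<omega> $ k) \<in> borel_measurable (generated_by P)"
proof -
  let ?R = "PiM P (\<lambda>(i, t). PiM {k. own k = i} (\<lambda>_. borel :: real measure))"
  have fam: "(\<lambda>\<omega>. \<lambda>(i, t)\<in>P. block own i (z t \<omega>)) \<in> measurable (generated_by P) ?R"
    unfolding generated_by_def
    by (rule measurable_vimage_algebra1) (simp add: space_PiM block_def restrict_PiE_iff case_prod_beta)
  have blk: "(\<lambda>y. y (own k, t)) \<in> measurable ?R (PiM {l. own l = own k} (\<lambda>_. borel))"
    using measurable_component_singleton[OF assms, of "\<lambda>(i, t). PiM {k. own k = i} (\<lambda>_. borel :: real measure)"]
    by simp
  have cmp: "(\<lambda>y. y k) \<in> measurable (PiM {l. own l = own k} (\<lambda>_. borel :: real measure)) borel"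
    by (rule measurable_component_singleton) simp
  have "(\<lambda>\<omega>. (\<lambda>(i, t)\<in>P. block own i (z t \<omega>)) (own k, t) k) \<in> borel_measurable (generated_by P)"
    by (rule measurable_compose[OF measurable_compose[OF fam blk] cmp])
  then show ?thesis using assms by (simp add: z_component)
qed

lemma indep_var_generated_by:
  assumes "P \<inter> Q = {}" "X \<in> measurable (generated_by P) S" "Y \<in> measurable (generated_by Q) T"
  shows "indep_var S X T Y"
proof (rule indep_var_vimage_measurable)
  show "indep_var (PiM P (\<lambda>(i, t). PiM {k. own k = i} (\<lambda>_. borel)))
          (\<lambda>\<omega>. \<lambda>(i, t)\<in>P. block own i (z t \<omega>))
          (PiM Q (\<lambda>(i, t). PiM {k. own k = i} (\<lambda>_. borel)))
          (\<lambda>\<omega>. \<lambda>(i, t)\<in>Q. block own i (z t \<omega>))"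
    using indep_var_restrict[OF z_indep assms(1)] unfolding case_prod_unfold by simp
  show "X \<in> measurable (vimage_algebra (space M) (\<lambda>\<omega>. \<lambda>(i, t)\<in>P. block own i (z t \<omega>))
          (PiM P (\<lambda>(i, t). PiM {k. own k = i} (\<lambda>_. borel)))) S"
    "Y \<in> measurable (vimage_algebra (space M) (\<lambda>\<omega>. \<lambda>(i, t)\<in>Q. block own i (z t \<omega>))
          (PiM Q (\<lambda>(i, t). PiM {k. own k = i} (\<lambda>_. borel)))) T"
    using assms(2,3) unfolding generated_by_def .
qed

text \<open>
  Two coordinates at the same time are orthonormal for one of two reasons: inside a block because
  the law of the block is a product, across blocks because the blocks are independent.
\<close>

lemma z_second_moments:
  "expectation (\<lambda>\<omega>. z t \<omega> $ k * z t \<omega> $ l) = (if k = l then 1 else 0)"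
  "integrable M (\<lambda>\<omega>. z t \<omega> $ k * z t \<omega> $ l)"
proof -
  note prod = gaussian_block_prod[OF _ block_measurable z_normal]
  have m1: "integral\<^sup>L lborel (\<lambda>r. std_normal_density r * r) = 0"
    using integral_std_normal_moment_odd[of 0] by simp
  have first: "integrable M (\<lambda>\<omega>. z t \<omega> $ k)" "expectation (\<lambda>\<omega>. z t \<omega> $ k) = 0" for k
    using prod[of "{k}" "own k" t "\<lambda>_. 1"] m1 by simp_all
  have "expectation (\<lambda>\<omega>. z t \<omega> $ k * z t \<omega> $ l) = (if k = l then 1 else 0)
      \<and> integrable M (\<lambda>\<omega>. z t \<omega> $ k * z t \<omega> $ l)"
  proof (cases "k = l")
    case True
    then show ?thesis
      using prod[of "{k}" "own k" t "\<lambda>_. 2"] integral_std_normal_moment_even[of 1]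
      by (simp add: power2_eq_square)
  next
    case neq: False
    show ?thesis
    proof (cases "own k = own l")
      case True
      then show ?thesis
        using prod[of "{k, l}" "own k" t "\<lambda>_. 1"] neq m1 by simp
    next
      case False
      have "indep_var borel (\<lambda>\<omega>. z t \<omega> $ k) borel (\<lambda>\<omega>. z t \<omega> $ l)"
        by (rule indep_var_generated_by[of "{(own k, t)}" "{(own l, t)}"])
           (use False in \<open>auto intro: z_component_generated_by\<close>)
      then show ?thesis
        using indep_var_lebesgue_integral[OF _ first(1) first(1)]
          indep_var_integrable[OF _ first(1) first(1)] first(2) neq by auto
    qed
  qed
  then show "expectation (\<lambda>\<omega>. z t \<omega> $ k * z t \<omega> $ l) = (if k = l then 1 else 0)"
    "integrable M (\<lambda>\<omega>. z t \<omega> $ k * z t \<omega> $ l)" by auto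
qed

text \<open>
  All directions have the same law, so one constant serves all times.  The sixth moment is the
  highest one needed: it comes from the squared smoothing error \<open>(L u \<parallel>z\<parallel>\<^sup>3)\<^sup>2\<close>.  The summand \<open>1\<close> lets
  the same quantity dominate the lower powers of \<open>\<parallel>z\<parallel>\<close>.
\<close>

definition moment_bound :: real where
  "moment_bound = 1 + real CARD('d) ^ 7 * integral\<^sup>L lborel (\<lambda>r. std_normal_density r * r ^ 6)"

lemma norm_z_sixth_moment:
  "integrable M (\<lambda>\<omega>. 1 + norm (z t \<omega>) ^ 6)"
  "expectation (\<lambda>\<omega>. 1 + norm (z t \<omega>) ^ 6) \<le> moment_bound"
proof -
  let ?b = "\<lambda>\<omega>. real CARD('d) ^ 6 * (\<Sum>k\<in>UNIV. (z t \<omega> $ k) ^ 6)"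
  note prod = gaussian_block_prod[OF _ block_measurable z_normal]
  have six: "integrable M (\<lambda>\<omega>. (z t \<omega> $ k) ^ 6)"
    "expectation (\<lambda>\<omega>. (z t \<omega> $ k) ^ 6) = integral\<^sup>L lborel (\<lambda>r. std_normal_density r * r ^ 6)" for k
    using prod[of "{k}" "own k" t "\<lambda>_. 6"] by simp_all
  have le: "norm (z t \<omega>) ^ 6 \<le> ?b \<omega>" for \<omega>
    using norm_vec_power_le[of "z t \<omega>" 6] by (simp add: power_even_abs)
  have int: "integrable M ?b" using six by simp
  have int6: "integrable M (\<lambda>\<omega>. norm (z t \<omega>) ^ 6)"
    by (rule Bochner_Integration.integrable_bound[OF int])
       (use le in \<open>auto intro!: order_trans[OF le abs_ge_self]\<close>)
  then show "integrable M (\<lambda>\<omega>. 1 + norm (z t \<omega>) ^ 6)" by simp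
  have "expectation (\<lambda>\<omega>. norm (z t \<omega>) ^ 6) \<le> expectation ?b"
    using int6 int le by (intro integral_mono) auto
  also have "\<dots> = real CARD('d) ^ 7 * integral\<^sup>L lborel (\<lambda>r. std_normal_density r * r ^ 6)"
    using six power_add[of "real CARD('d)" 6 1] by simp
  finally show "expectation (\<lambda>\<omega>. 1 + norm (z t \<omega>) ^ 6) \<le> moment_bound"
    using int6 by (simp add: moment_bound_def prob_space)
qed

lemma moment_bound_ge_1: "moment_bound \<ge> 1"
proof -
  have "0 \<le> expectation (\<lambda>\<omega>. norm (z 0 \<omega>) ^ 6)" by simp
  moreover have "integrable M (\<lambda>\<omega>. norm (z 0 \<omega>) ^ 6)"
    using Bochner_Integration.integrable_diff[OF norm_z_sixth_moment(1)[of 0] integrable_const[of 1]] by simp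
  then have "expectation (\<lambda>\<omega>. 1 + norm (z 0 \<omega>) ^ 6) = 1 + expectation (\<lambda>\<omega>. norm (z 0 \<omega>) ^ 6)"
    by (simp add: prob_space)
  ultimately show ?thesis
    using norm_z_sixth_moment(2)[of 0] by linarith
qed

text \<open>
  An estimate at time \<open>t\<close> involves directions of several recent times.  Their squared norms are
  collected in one random variable that dominates all of them.
\<close>

definition window :: "nat \<Rightarrow> nat \<Rightarrow> 'w \<Rightarrow> real" where
  "window m t \<omega> = (\<Sum>r = t - m..t. (norm (z r \<omega>))\<^sup>2)"

lemma window_measurable [measurable]: "window m t \<in> borel_measurable M"
  unfolding window_def by measurable

lemma window_nonneg: "0 \<le> window m t \<omega>"
  unfolding window_def by (intro sum_nonneg) auto

lemma norm_z_le_window: "t - m \<le> r \<Longrightarrow> r \<le> t \<Longrightarrow> (norm (z r \<omega>))\<^sup>2 \<le> window m t \<omega>"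
  unfolding window_def by (intro member_le_sum) auto

lemma window_mono: "t - m \<le> q - m' \<Longrightarrow> q \<le> t \<Longrightarrow> window m' q \<omega> \<le> window m t \<omega>"
  unfolding window_def by (intro sum_mono2) auto

text \<open>
  By Cauchy-Schwarz and \<open>y\<^sup>p \<le> 1 + y\<^sup>6\<close> for \<open>p \<le> 6\<close>, both the window sum and its square are dominated by the same
  combination of sixth moments.
\<close>

lemma window_moments:
  defines "K m \<equiv> (real m + 1)\<^sup>2 * moment_bound"
  shows "integrable M (window m t)" "integrable M (\<lambda>\<omega>. (window m t \<omega>)\<^sup>2)"
    "expectation (window m t) \<le> K m" "expectation (\<lambda>\<omega>. (window m t \<omega>)\<^sup>2) \<le> K m"
proof -
  let ?I = "{t - m..t}"
  have card: "real (card ?I) \<le> real m + 1" by auto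
  let ?W = "\<lambda>\<omega>. (real m + 1) * (\<Sum>r\<in>?I. 1 + norm (z r \<omega>) ^ 6)"
  have dom: "y ^ p \<le> 1 + y ^ q" if "0 \<le> y" "p \<le> q" for y :: real and p q
  proof (cases "y \<le> 1")
    case True
    then have "y ^ p \<le> 1" using that by (simp add: power_le_one)
    then show ?thesis using that zero_le_power[of y q] by linarith
  next
    case False
    then have "y ^ p \<le> y ^ q" using that by (intro power_increasing) auto
    then show ?thesis by simp
  qed
  have S0: "0 \<le> (\<Sum>r\<in>?I. 1 + norm (z r \<omega>) ^ 6)" for \<omega> by (intro sum_nonneg) auto
  have le1: "window m t \<omega> \<le> ?W \<omega>" for \<omega>
  proof -
    have "window m t \<omega> \<le> 1 * (\<Sum>r\<in>?I. 1 + norm (z r \<omega>) ^ 6)"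
      unfolding window_def by (simp, intro sum_mono dom) auto
    also have "\<dots> \<le> ?W \<omega>" using S0 by (intro mult_right_mono) auto
    finally show ?thesis .
  qed
  have le2: "(window m t \<omega>)\<^sup>2 \<le> ?W \<omega>" for \<omega>
  proof -
    have "(window m t \<omega>)\<^sup>2 \<le> (\<Sum>r\<in>?I. ((norm (z r \<omega>))\<^sup>2)\<^sup>2) * real (card ?I)"
      unfolding window_def by (rule sum_squared_le_sum_of_squares)
    also have "\<dots> \<le> (\<Sum>r\<in>?I. 1 + norm (z r \<omega>) ^ 6) * (real m + 1)"
      using S0 card by (intro mult_mono sum_mono) (auto simp: power_mult[symmetric] intro!: dom)
    finally show ?thesis by (simp add: mult.commute)
  qed
  have intW: "integrable M ?W" using norm_z_sixth_moment(1) by (intro integrable_mult_right integrable_sum) auto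
  have EW: "expectation ?W \<le> K m"
  proof -
    have "expectation ?W = (real m + 1) * (\<Sum>r\<in>?I. expectation (\<lambda>\<omega>. 1 + norm (z r \<omega>) ^ 6))"
      by (simp only: integral_mult_right_zero Bochner_Integration.integral_sum[OF norm_z_sixth_moment(1)])
    also have "\<dots> \<le> (real m + 1) * ((real m + 1) * moment_bound)"
    proof (intro mult_left_mono)
      have "(\<Sum>r\<in>?I. expectation (\<lambda>\<omega>. 1 + norm (z r \<omega>) ^ 6)) \<le> (\<Sum>r\<in>?I. moment_bound)"
        by (intro sum_mono norm_z_sixth_moment(2))
      also have "\<dots> \<le> (real m + 1) * moment_bound"
        using card moment_bound_ge_1 by (simp only: sum_constant, intro mult_right_mono) auto
      finally show "(\<Sum>r\<in>?I. expectation (\<lambda>\<omega>. 1 + norm (z r \<omega>) ^ 6)) \<le> (real m + 1) * moment_bound" .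
    qed auto
    finally show ?thesis by (simp add: K_def power2_eq_square mult.assoc)
  qed
  show 1: "integrable M (window m t)"
    by (rule Bochner_Integration.integrable_bound[OF intW])
       (auto simp: window_nonneg intro!: order_trans[OF le1 abs_ge_self])
  show 2: "integrable M (\<lambda>\<omega>. (window m t \<omega>)\<^sup>2)"
    by (rule Bochner_Integration.integrable_bound[OF intW])
       (auto intro!: order_trans[OF le2 abs_ge_self])
  show "expectation (window m t) \<le> K m"
    using integral_mono[OF 1 intW le1] EW by linarith
  show "expectation (\<lambda>\<omega>. (window m t \<omega>)\<^sup>2) \<le> K m"
    using integral_mono[OF 2 intW le2] EW by linarith
qed

end

section \<open>The delayed two-point algorithm\<close>

text \<open>
  The algorithm with arbitrary nonnegative step sizes and positive smoothing radii; their polynomial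
  decay enters only when the descent estimate is summed.
\<close>

locale delayed_two_point_descent = gaussian_blocks M own z
  for M :: "'w measure" and own :: "'d::finite \<Rightarrow> 'n::finite" and z :: "nat \<Rightarrow> 'w \<Rightarrow> real ^ 'd" +
  fixes f :: "'n \<Rightarrow> real ^ 'd \<Rightarrow> real" and G L :: real
    and \<tau> :: "'n \<Rightarrow> 'n \<Rightarrow> nat \<Rightarrow> int" and B :: nat
    and \<eta> u :: "nat \<Rightarrow> real" and x\<^sub>0 :: "real ^ 'd"
    and x :: "nat \<Rightarrow> 'w \<Rightarrow> real ^ 'd" and D :: "'n \<Rightarrow> nat \<Rightarrow> 'w \<Rightarrow> real"
  assumes f_lipschitz: "\<And>i. G-lipschitz_on UNIV (f i)"
    and f_smooth: "\<And>i. lsmooth L (f i)"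
    and delay: "\<And>i j t. 0 \<le> int t - \<tau> i j t \<and> int t - \<tau> i j t \<le> int B"
    and \<eta>_nonneg: "\<And>t. 0 \<le> \<eta> t"
    and u_pos: "\<And>t. 0 < u t"
    and x_init: "\<And>\<omega>. \<omega> \<in> space M \<Longrightarrow> x 0 \<omega> = x\<^sub>0"
    and D: "\<And>i t \<omega>. \<omega> \<in> space M \<Longrightarrow> D i t \<omega> = two_point_diff (f i) (u t) (x t \<omega>) (z t \<omega>)"
    and x_step: "\<And>t \<omega>. \<omega> \<in> space M \<Longrightarrow>
           x (Suc t) \<omega> = x t \<omega> - \<eta> t *\<^sub>R grad_estimate own \<tau> (\<lambda>j s. D j s \<omega>) (\<lambda>s. z s \<omega>) t"
begin

abbreviation F :: "real ^ 'd \<Rightarrow> real" where "F \<equiv> avg_cost f"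

abbreviation estimate :: "nat \<Rightarrow> 'w \<Rightarrow> real ^ 'd" where
  "estimate t \<omega> \<equiv> grad_estimate own \<tau> (\<lambda>j s. D j s \<omega>) (\<lambda>s. z s \<omega>) t"

lemma G_nonneg: "0 \<le> G" by (rule lipschitz_on_nonneg[OF f_lipschitz])

lemma f_differentiable: "f i differentiable (at y)" and grad_f_lipschitz: "L-lipschitz_on UNIV (grad (f i))"
  using f_smooth[of i] by (auto simp: lsmooth_def)

lemma L_nonneg: "0 \<le> L" by (rule lipschitz_on_nonneg[OF grad_f_lipschitz])

lemma stamp_in_window:
  assumes "0 \<le> \<tau> i j t" shows "t - B \<le> nat (\<tau> i j t)" "nat (\<tau> i j t) \<le> t"
  using delay[of t i j] assms by auto

lemma F_lipschitz: "G-lipschitz_on UNIV F" by (rule lipschitz_avg_cost[OF f_lipschitz])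

lemma F_smooth: "lsmooth L F" by (rule lsmooth_avg_cost[OF f_smooth])

lemma F_differentiable: "F differentiable (at y)" and grad_F_lipschitz: "L-lipschitz_on UNIV (grad F)"
  using F_smooth by (auto simp: lsmooth_def)

lemma grad_bound: "norm (grad (f i) y) \<le> G" "norm (grad F y) \<le> G"
  by (rule norm_grad_le_lipschitz f_differentiable f_lipschitz F_differentiable F_lipschitz)+

lemma grad_lipschitz:
  "norm (grad (f i) y - grad (f i) y') \<le> L * norm (y - y')" "norm (grad F y - grad F y') \<le> L * norm (y - y')"
  using lipschitz_onD[OF grad_f_lipschitz] lipschitz_onD[OF grad_F_lipschitz] by (simp_all add: dist_norm)

lemma f_measurable [measurable]: "f i \<in> borel_measurable borel" "F \<in> borel_measurable borel"
  by (rule borel_measurable_continuous_onI, rule lipschitz_on_continuous_on, rule f_lipschitz F_lipschitz)+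

lemma grad_measurable [measurable]:
  "grad (f i) \<in> borel_measurable borel" "grad F \<in> borel_measurable borel"
  by (rule borel_measurable_continuous_onI, rule lipschitz_on_continuous_on, rule grad_f_lipschitz grad_F_lipschitz)+

lemma nth_measurable [measurable]: "(\<lambda>v :: real ^ 'd. v $ k) \<in> borel_measurable borel"
  by (intro borel_measurable_continuous_onI continuous_intros)

lemma grad_F_nth: "grad F y $ k = (1 / real CARD('n)) * (\<Sum>j\<in>UNIV. grad (f j) y $ k)"
proof -
  have "grad F y = (1 / real CARD('n)) *\<^sub>R (\<Sum>j\<in>UNIV. grad (f j) y)"
    by (intro grad_eqI grad_avg_cost f_differentiable)
  then show ?thesis by simp
qed

subsection \<open>Measurability and independence of the iterates\<close>

text \<open>
  The iterate \<open>x r\<close> is built from directions at times before \<open>r\<close>.  The \<open>\<sigma>\<close>-algebra \<open>N\<close> is left open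
  in order to cover both ordinary measurability and measurability with respect to the past of \<open>s\<close>.
\<close>

lemma iterate_measurable_wrt:
  assumes space: "space N = space M"
    and z: "\<And>r. r < s \<Longrightarrow> z r \<in> borel_measurable N"
  shows "r \<le> s \<Longrightarrow> x r \<in> borel_measurable N"
proof (induction r rule: less_induct)
  case (less r)
  show ?case
  proof (cases r)
    case 0
    have "x 0 \<in> borel_measurable N \<longleftrightarrow> (\<lambda>_. x\<^sub>0) \<in> borel_measurable N"
      by (rule measurable_cong) (simp add: x_init space)
    with 0 show ?thesis by simp
  next
    case (Suc t)
    have x: "x q \<in> borel_measurable N" if "q \<le> t" for q using less that Suc by simp
    have z': "z q \<in> borel_measurable N" if "q \<le> t" for q using z less.prems that Suc by simp
    have D': "D j q \<in> borel_measurable N" if "q \<le> t" for j q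
    proof -
      note [measurable] = x[OF that] z'[OF that]
      have "D j q \<in> borel_measurable N \<longleftrightarrow>
          (\<lambda>\<omega>. two_point_diff (f j) (u q) (x q \<omega>) (z q \<omega>)) \<in> borel_measurable N"
        by (rule measurable_cong) (simp add: D space)
      moreover have "(\<lambda>\<omega>. two_point_diff (f j) (u q) (x q \<omega>) (z q \<omega>)) \<in> borel_measurable N"
        unfolding two_point_diff_def by measurable
      ultimately show ?thesis by simp
    qed
    have "(\<lambda>\<omega>. estimate t \<omega> $ k) \<in> borel_measurable N" for k
      unfolding grad_estimate_def vec_lambda_beta
    proof (intro borel_measurable_times borel_measurable_const borel_measurable_sum)
      fix j assume "j \<in> {j. 0 \<le> \<tau> (own k) j t}"
      then have q: "nat (\<tau> (own k) j t) \<le> t" using stamp_in_window by blast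
      show "D j (nat (\<tau> (own k) j t)) \<in> borel_measurable N" using D'[OF q] .
      show "(\<lambda>\<omega>. z (nat (\<tau> (own k) j t)) \<omega> $ k) \<in> borel_measurable N"
        using measurable_compose[OF z'[OF q] nth_measurable] .
    qed
    then have [measurable]: "estimate t \<in> borel_measurable N" by (rule borel_measurable_vecI)
    have [measurable]: "x t \<in> borel_measurable N" using x by simp
    have "x r \<in> borel_measurable N \<longleftrightarrow> (\<lambda>\<omega>. x t \<omega> - \<eta> t *\<^sub>R estimate t \<omega>) \<in> borel_measurable N"
      unfolding Suc by (rule measurable_cong) (simp add: x_step space)
    moreover have "(\<lambda>\<omega>. x t \<omega> - \<eta> t *\<^sub>R estimate t \<omega>) \<in> borel_measurable N" by measurable
    ultimately show ?thesis by simp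
  qed
qed

lemma x_measurable [measurable]: "x t \<in> borel_measurable M"
  by (rule iterate_measurable_wrt[of M t]) auto

lemma D_measurable [measurable]: "D j t \<in> borel_measurable M"
proof -
  have "D j t \<in> borel_measurable M \<longleftrightarrow>
      (\<lambda>\<omega>. two_point_diff (f j) (u t) (x t \<omega>) (z t \<omega>)) \<in> borel_measurable M"
    by (rule measurable_cong) (simp add: D)
  moreover have "(\<lambda>\<omega>. two_point_diff (f j) (u t) (x t \<omega>) (z t \<omega>)) \<in> borel_measurable M"
    unfolding two_point_diff_def by measurable
  ultimately show ?thesis by simp
qed

lemma indep_iterate_direction:
  assumes h: "h \<in> borel_measurable borel" and \<phi>: "\<phi> \<in> borel_measurable borel"
  shows "indep_var borel (\<lambda>\<omega>. h (x s \<omega>)) borel (\<lambda>\<omega>. \<phi> (z s \<omega>))"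
proof (rule indep_var_generated_by)
  let ?past = "UNIV \<times> {..<s} :: ('n \<times> nat) set" and ?now = "UNIV \<times> {s} :: ('n \<times> nat) set"
  show "?past \<inter> ?now = {}" by auto
  have "x s \<in> borel_measurable (generated_by ?past)"
    by (rule iterate_measurable_wrt[of _ s])
       (auto intro!: borel_measurable_vecI z_component_generated_by)
  then show "(\<lambda>\<omega>. h (x s \<omega>)) \<in> borel_measurable (generated_by ?past)" using h by measurable
  have "z s \<in> borel_measurable (generated_by ?now)"
    by (auto intro!: borel_measurable_vecI z_component_generated_by)
  then show "(\<lambda>\<omega>. \<phi> (z s \<omega>)) \<in> borel_measurable (generated_by ?now)" using \<phi> by measurable
qed

lemma bounded_integrable:
  assumes [measurable]: "h \<in> borel_measurable borel" and "\<And>y. \<bar>h y\<bar> \<le> c"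
  shows "integrable M (\<lambda>\<omega>. h (x t \<omega>) :: real)"
  by (rule integrable_const_bound[where B = c]) (use assms in auto)

text \<open>
  Expand the inner product into coordinates.  The iterate at time \<open>s\<close> is independent of the
  direction drawn at time \<open>s\<close>, so each summand factorizes, and only \<open>l = k\<close> survives because
  \<open>E z\<^sub>l z\<^sub>k = \<delta>\<^sub>l\<^sub>k\<close>.
\<close>

lemma expectation_directional:
  fixes h :: "real ^ 'd \<Rightarrow> real" and v :: "real ^ 'd \<Rightarrow> real ^ 'd"
  assumes h [measurable]: "h \<in> borel_measurable borel" "\<And>y. \<bar>h y\<bar> \<le> c"
    and v [measurable]: "v \<in> borel_measurable borel" "\<And>y. norm (v y) \<le> c'"
  shows "integrable M (\<lambda>\<omega>. h (x s \<omega>) * inner (v (x s \<omega>)) (z s \<omega>) * z s \<omega> $ k)"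
    and "expectation (\<lambda>\<omega>. h (x s \<omega>) * inner (v (x s \<omega>)) (z s \<omega>) * z s \<omega> $ k)
           = expectation (\<lambda>\<omega>. h (x s \<omega>) * v (x s \<omega>) $ k)"
proof -
  have eq: "h (x s \<omega>) * inner (v (x s \<omega>)) (z s \<omega>) * z s \<omega> $ k
      = (\<Sum>l\<in>UNIV. (h (x s \<omega>) * v (x s \<omega>) $ l) * (z s \<omega> $ l * z s \<omega> $ k))" for \<omega>
    by (simp add: inner_vec_def sum_distrib_left sum_distrib_right mult_ac)
  have c: "0 \<le> c" using h(2)[of 0] by linarith
  have int: "integrable M (\<lambda>\<omega>. h (x s \<omega>) * v (x s \<omega>) $ l)" for l
  proof (rule bounded_integrable[where c = "c * c'"])
    show "\<bar>h y * v y $ l\<bar> \<le> c * c'" for y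
      unfolding abs_mult using h(2) v(2) c by (intro mult_mono order_trans[OF component_le_norm_cart]) auto
  qed measurable
  have ind: "indep_var borel (\<lambda>\<omega>. h (x s \<omega>) * v (x s \<omega>) $ l) borel (\<lambda>\<omega>. z s \<omega> $ l * z s \<omega> $ k)" for l
    by (rule indep_iterate_direction[of "\<lambda>y. h y * v y $ l" "\<lambda>y. y $ l * y $ k"]) measurable
  have int': "integrable M (\<lambda>\<omega>. (h (x s \<omega>) * v (x s \<omega>) $ l) * (z s \<omega> $ l * z s \<omega> $ k))" for l
    by (rule indep_var_integrable[OF ind int z_second_moments(2)])
  show "integrable M (\<lambda>\<omega>. h (x s \<omega>) * inner (v (x s \<omega>)) (z s \<omega>) * z s \<omega> $ k)"
    unfolding eq by (intro Bochner_Integration.integrable_sum int')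
  have "expectation (\<lambda>\<omega>. h (x s \<omega>) * inner (v (x s \<omega>)) (z s \<omega>) * z s \<omega> $ k)
      = (\<Sum>l\<in>UNIV. expectation (\<lambda>\<omega>. (h (x s \<omega>) * v (x s \<omega>) $ l) * (z s \<omega> $ l * z s \<omega> $ k)))"
    unfolding eq by (rule Bochner_Integration.integral_sum[OF int'])
  also have "\<dots> = (\<Sum>l\<in>UNIV. expectation (\<lambda>\<omega>. h (x s \<omega>) * v (x s \<omega>) $ l) * (if l = k then 1 else 0))"
    by (intro sum.cong refl) (subst indep_var_lebesgue_integral[OF ind int z_second_moments(2)], simp only: z_second_moments(1))
  also have "\<dots> = expectation (\<lambda>\<omega>. h (x s \<omega>) * v (x s \<omega>) $ k)"
    by (simp add: mult_delta_right)
  finally show "expectation (\<lambda>\<omega>. h (x s \<omega>) * inner (v (x s \<omega>)) (z s \<omega>) * z s \<omega> $ k)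
           = expectation (\<lambda>\<omega>. h (x s \<omega>) * v (x s \<omega>) $ k)" .
qed

subsection \<open>Pathwise bounds\<close>

lemma D_bound: "\<omega> \<in> space M \<Longrightarrow> \<bar>D j t \<omega>\<bar> \<le> G * norm (z t \<omega>)"
  using two_point_diff_bound[OF f_lipschitz u_pos] by (simp add: D)

lemma D_direction_bound:
  assumes "\<omega> \<in> space M"
  shows "\<bar>D j t \<omega> * z t \<omega> $ k\<bar> \<le> G * (norm (z t \<omega>))\<^sup>2"
proof -
  have "\<bar>D j t \<omega> * z t \<omega> $ k\<bar> \<le> (G * norm (z t \<omega>)) * norm (z t \<omega>)"
    unfolding abs_mult using D_bound[OF assms] G_nonneg
    by (intro mult_mono component_le_norm_cart) auto
  then show ?thesis by (simp add: power2_eq_square mult.assoc)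
qed

text \<open>
  Every summand of the estimate uses a direction from the window of length \<open>B\<close>, and
  \<open>\<bar>D\<^sub>j z\<^sub>k\<bar> \<le> G \<parallel>z\<parallel>\<^sup>2\<close> since \<open>D\<^sub>j\<close> is at most \<open>G \<parallel>z\<parallel>\<close> for a \<open>G\<close>-Lipschitz cost, whatever the radius is.
\<close>

lemma norm_estimate_le:
  assumes "\<omega> \<in> space M"
  shows "norm (estimate t \<omega>) \<le> real CARD('d) * G * window B t \<omega>"
proof -
  have "\<bar>estimate t \<omega> $ k\<bar> \<le> G * window B t \<omega>" for k
  proof -
    let ?J = "{j. 0 \<le> \<tau> (own k) j t}"
    let ?s = "\<lambda>j. nat (\<tau> (own k) j t)"
    have "\<bar>\<Sum>j\<in>?J. D j (?s j) \<omega> * z (?s j) \<omega> $ k\<bar> \<le> (\<Sum>j\<in>?J. G * window B t \<omega>)"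
    proof (rule order_trans[OF sum_abs], rule sum_mono)
      fix j assume "j \<in> ?J"
      then have "(norm (z (?s j) \<omega>))\<^sup>2 \<le> window B t \<omega>"
        using stamp_in_window by (intro norm_z_le_window) auto
      then show "\<bar>D j (?s j) \<omega> * z (?s j) \<omega> $ k\<bar> \<le> G * window B t \<omega>"
        using D_direction_bound[OF assms] G_nonneg by (meson mult_left_mono order_trans)
    qed
    also have "\<dots> \<le> real CARD('n) * (G * window B t \<omega>)"
      using G_nonneg window_nonneg by (simp only: sum_constant) (intro mult_right_mono, auto intro: card_mono)
    finally show ?thesis by (simp add: grad_estimate_def abs_mult divide_le_eq mult.commute)
  qed
  then have "(\<Sum>k\<in>UNIV. \<bar>estimate t \<omega> $ k\<bar>) \<le> real CARD('d) * (G * window B t \<omega>)"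
    using sum_bounded_above[of UNIV "\<lambda>k. \<bar>estimate t \<omega> $ k\<bar>" "G * window B t \<omega>"] by simp
  then show ?thesis using norm_le_l1_cart[of "estimate t \<omega>"] by (simp add: mult.assoc)
qed

definition step_sum :: "nat \<Rightarrow> real" where "step_sum t = (\<Sum>q = t - B..t. \<eta> q)"

lemma step_sum_nonneg: "0 \<le> step_sum t"
  unfolding step_sum_def by (intro sum_nonneg \<eta>_nonneg)

lemma eta_le_step_sum: "\<eta> t \<le> step_sum t"
  unfolding step_sum_def using \<eta>_nonneg by (intro member_le_sum) auto

text \<open>
  The window has to have length \<open>2 B\<close>: the steps between \<open>s\<close> and \<open>t\<close> are at most \<open>B\<close> old, and the
  directions that they use are older by at most another \<open>B\<close>.
\<close>

lemma drift_bound: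
  assumes \<omega>: "\<omega> \<in> space M" and s: "t - B \<le> s" "s \<le> t"
  shows "norm (x t \<omega> - x s \<omega>) \<le> real CARD('d) * G * step_sum t * window (2 * B) t \<omega>"
proof -
  let ?V = "window (2 * B) t \<omega>"
  have "norm (x r \<omega> - x s \<omega>) \<le> (\<Sum>q\<in>{s..<r}. \<eta> q) * (real CARD('d) * G * ?V)" if "s \<le> r" "r \<le> t" for r
    using that
  proof (induction r rule: dec_induct)
    case base
    then show ?case by simp
  next
    case (step r)
    have "norm (estimate r \<omega>) \<le> real CARD('d) * G * window B r \<omega>" by (rule norm_estimate_le[OF \<omega>])
    also have "\<dots> \<le> real CARD('d) * G * ?V"
      using step s G_nonneg by (intro mult_left_mono window_mono) auto
    finally have "\<eta> r * norm (estimate r \<omega>) \<le> \<eta> r * (real CARD('d) * G * ?V)"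
      by (rule mult_left_mono[OF _ \<eta>_nonneg])
    moreover have "norm (x (Suc r) \<omega> - x s \<omega>) \<le> norm (x r \<omega> - x s \<omega>) + \<eta> r * norm (estimate r \<omega>)"
      using norm_triangle_ineq4[of "x r \<omega> - x s \<omega>" "\<eta> r *\<^sub>R estimate r \<omega>"] \<eta>_nonneg[of r]
      by (simp add: x_step[OF \<omega>] algebra_simps)
    ultimately have "norm (x (Suc r) \<omega> - x s \<omega>)
        \<le> (\<Sum>q\<in>{s..<r}. \<eta> q) * (real CARD('d) * G * ?V) + \<eta> r * (real CARD('d) * G * ?V)"
      using step by simp
    then show ?case using step.hyps by (simp add: distrib_right)
  qed
  from this[OF s(2) order_refl]
  have "norm (x t \<omega> - x s \<omega>) \<le> (\<Sum>q\<in>{s..<t}. \<eta> q) * (real CARD('d) * G * ?V)" .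
  also have "\<dots> \<le> step_sum t * (real CARD('d) * G * ?V)"
    unfolding step_sum_def using s G_nonneg window_nonneg \<eta>_nonneg
    by (intro mult_right_mono sum_mono2) auto
  finally show ?thesis by (simp add: mult_ac)
qed


subsection \<open>Expected descent\<close>

definition window_bound :: real where "window_bound = (real (2 * B) + 1)\<^sup>2 * moment_bound"

lemma window_2B_moments:
  "integrable M (window (2 * B) t)" "integrable M (\<lambda>\<omega>. (window (2 * B) t \<omega>)\<^sup>2)"
  "expectation (window (2 * B) t) \<le> window_bound" "expectation (\<lambda>\<omega>. (window (2 * B) t \<omega>)\<^sup>2) \<le> window_bound"
  unfolding window_bound_def by (rule window_moments)+

lemma grad_nth_bound: "\<bar>grad (f i) y $ k\<bar> \<le> G" "\<bar>grad F y $ k\<bar> \<le> G"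
  using grad_bound component_le_norm_cart by (meson order_trans)+

text \<open>
  With \<open>a\<close> and \<open>b\<close> the \<open>k\<close>-th partial derivatives of \<open>F\<close> and \<open>f\<^sub>j\<close> along the iterates and \<open>w\<close> the directional
  derivative at the stale point, split
  \<open>a(t) D z\<^sub>k = a(t) (D - w) z\<^sub>k + (a(t) - a(s)) w z\<^sub>k + a(s) w z\<^sub>k\<close>.  The first part is the smoothing
  error, the second the drift, and the third has expectation \<open>E a(s) b(s)\<close>.  The difference
  \<open>a(t) b(t) - a(s) b(s)\<close> on the left vanishes up to drift; it is included in order that the
  expectation of the left-hand side only involves the current point.
\<close>

lemma cross_term_pathwise:
  fixes j :: 'n and k :: 'd
  assumes \<omega>: "\<omega> \<in> space M" and s: "t - B \<le> s" "s \<le> t"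
  defines "a \<equiv> \<lambda>r. grad F (x r \<omega>) $ k" and "b \<equiv> \<lambda>r. grad (f j) (x r \<omega>) $ k"
    and "V \<equiv> window (2 * B) t \<omega>"
  shows "a s * inner (grad (f j) (x s \<omega>)) (z s \<omega>) * z s \<omega> $ k + a t * b t - a s * b s
      - (a t)\<^sup>2 / 2 - L\<^sup>2 * (u s)\<^sup>2 / 2 * (1 + norm (z s \<omega>) ^ 6)
      - real CARD('d) * G\<^sup>2 * L * step_sum t * (V\<^sup>2 + 2 * V)
      \<le> a t * (D j s \<omega> * z s \<omega> $ k)"
proof -
  let ?w = "inner (grad (f j) (x s \<omega>)) (z s \<omega>)" and ?n = "norm (z s \<omega>)" and ?z = "z s \<omega> $ k"
  define \<Delta> where "\<Delta> = real CARD('d) * G * step_sum t * V"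
  have \<Delta>: "norm (x t \<omega> - x s \<omega>) \<le> \<Delta>" unfolding \<Delta>_def V_def by (rule drift_bound[OF \<omega> s])
  have \<Delta>0: "0 \<le> \<Delta>" using \<Delta> norm_ge_zero order_trans by blast
  have nV: "?n\<^sup>2 \<le> V" unfolding V_def using s by (intro norm_z_le_window) auto
  have zn: "\<bar>?z\<bar> \<le> ?n" by (rule component_le_norm_cart)
  have wn: "\<bar>?w\<bar> \<le> G * ?n"
    using Cauchy_Schwarz_ineq2[of "grad (f j) (x s \<omega>)" "z s \<omega>"] grad_bound(1)[of j "x s \<omega>"]
    by (meson mult_right_mono norm_ge_zero order_trans)
  have da: "\<bar>a t - a s\<bar> \<le> L * \<Delta>"
    using component_le_norm_cart[of "grad F (x t \<omega>) - grad F (x s \<omega>)" k]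
      grad_lipschitz(2)[of "x t \<omega>" "x s \<omega>"] mult_left_mono[OF \<Delta> L_nonneg] by (simp add: a_def)
  have db: "\<bar>b t - b s\<bar> \<le> L * \<Delta>"
    using component_le_norm_cart[of "grad (f j) (x t \<omega>) - grad (f j) (x s \<omega>)" k]
      grad_lipschitz(1)[of j "x t \<omega>" "x s \<omega>"] mult_left_mono[OF \<Delta> L_nonneg] by (simp add: b_def)
  have aG: "\<bar>a t\<bar> \<le> G" and bG: "\<bar>b s\<bar> \<le> G" by (simp_all add: a_def b_def grad_nth_bound)
  \<comment> \<open>Young's inequality: the cost is half of \<open>a(t)\<^sup>2\<close>, the gain is a second power of the radius.\<close>
  have bias: "- (a t)\<^sup>2 / 2 - L\<^sup>2 * (u s)\<^sup>2 / 2 * (1 + ?n ^ 6) \<le> a t * ((D j s \<omega> - ?w) * ?z)"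
  proof -
    let ?p = "L * u s * ?n ^ 3"
    have "\<bar>(D j s \<omega> - ?w) * ?z\<bar> \<le> (L * u s * ?n\<^sup>2) * ?n"
      unfolding abs_mult D[OF \<omega>] using L_nonneg u_pos[of s]
      by (intro mult_mono two_point_diff_first_order f_smooth u_pos zn) auto
    then have p: "\<bar>(D j s \<omega> - ?w) * ?z\<bar> \<le> ?p" by (simp add: power2_eq_square power3_eq_cube mult_ac)
    have "\<bar>a t * ((D j s \<omega> - ?w) * ?z)\<bar> \<le> \<bar>a t\<bar> * ?p"
      unfolding abs_mult[of "a t"] using p by (intro mult_left_mono) auto
    moreover have "\<bar>a t\<bar> * ?p \<le> (a t)\<^sup>2 / 2 + ?p\<^sup>2 / 2"
      using sum_squares_bound[of "\<bar>a t\<bar>" ?p] by simp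
    moreover have "?p\<^sup>2 = L\<^sup>2 * (u s)\<^sup>2 * ?n ^ 6" by (simp add: power_mult_distrib power_mult[symmetric])
    moreover have "L\<^sup>2 * (u s)\<^sup>2 * ?n ^ 6 / 2 \<le> L\<^sup>2 * (u s)\<^sup>2 / 2 * (1 + ?n ^ 6)"
      by (simp add: distrib_left add_divide_distrib)
    ultimately show ?thesis by linarith
  qed
  have shift: "- (L * \<Delta> * (G * V)) \<le> (a t - a s) * (?w * ?z)"
  proof -
    have "\<bar>?w * ?z\<bar> \<le> (G * ?n) * ?n" unfolding abs_mult using wn zn G_nonneg by (intro mult_mono) auto
    also have "\<dots> \<le> G * V" using mult_left_mono[OF nV G_nonneg] by (simp add: power2_eq_square mult.assoc)
    finally have "\<bar>(a t - a s) * (?w * ?z)\<bar> \<le> L * \<Delta> * (G * V)"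
      unfolding abs_mult[of "a t - a s"] using da L_nonneg \<Delta>0 by (intro mult_mono) auto
    then show ?thesis by linarith
  qed
  have prod: "a t * b t - a s * b s \<le> 2 * G * L * \<Delta>"
  proof -
    have "a t * b t - a s * b s = a t * (b t - b s) + (a t - a s) * b s" by (simp add: algebra_simps)
    also have "\<dots> \<le> \<bar>a t\<bar> * \<bar>b t - b s\<bar> + \<bar>a t - a s\<bar> * \<bar>b s\<bar>"
      unfolding abs_mult[symmetric] by linarith
    also have "\<dots> \<le> G * (L * \<Delta>) + (L * \<Delta>) * G"
      using aG bG da db G_nonneg L_nonneg \<Delta>0 by (intro add_mono mult_mono) auto
    finally show ?thesis by (simp add: mult_ac)
  qed
  have "L * \<Delta> * (G * V) + 2 * G * L * \<Delta> = real CARD('d) * G\<^sup>2 * L * step_sum t * (V\<^sup>2 + 2 * V)"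
    unfolding \<Delta>_def by (simp add: power2_eq_square algebra_simps)
  moreover have "a t * (D j s \<omega> * ?z)
      = a t * ((D j s \<omega> - ?w) * ?z) + (a t - a s) * (?w * ?z) + a s * ?w * ?z"
    by (simp add: algebra_simps)
  ultimately show ?thesis using bias shift prod by linarith
qed

lemma cross_term_integrable:
  "integrable M (\<lambda>\<omega>. grad F (x t \<omega>) $ k * (D j s \<omega> * z s \<omega> $ k))"
proof (rule Bochner_Integration.integrable_bound)
  show "integrable M (\<lambda>\<omega>. G * (G * window (2 * B) s \<omega>))"
    using window_2B_moments(1) by (intro integrable_mult_right)
  have "\<bar>grad F (x t \<omega>) $ k * (D j s \<omega> * z s \<omega> $ k)\<bar> \<le> G * (G * window (2 * B) s \<omega>)"
    if "\<omega> \<in> space M" for \<omega>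
  proof -
    have "\<bar>D j s \<omega> * z s \<omega> $ k\<bar> \<le> G * window (2 * B) s \<omega>"
      using D_direction_bound[OF that] mult_left_mono[OF norm_z_le_window G_nonneg] by (meson diff_le_self order_refl order_trans)
    then show ?thesis unfolding abs_mult[of "grad F (x t \<omega>) $ k"]
      using grad_nth_bound G_nonneg by (intro mult_mono) auto
  qed
  then show "AE \<omega> in M. norm (grad F (x t \<omega>) $ k * (D j s \<omega> * z s \<omega> $ k)) \<le> norm (G * (G * window (2 * B) s \<omega>))"
    using abs_ge_self order_trans by (intro AE_I2) (simp only: real_norm_def, blast)
qed measurable

lemma grad_products_integrable:
  "integrable M (\<lambda>\<omega>. grad F (x r \<omega>) $ k * grad (f j) (x r \<omega>) $ k)"
  "integrable M (\<lambda>\<omega>. (grad F (x r \<omega>) $ k)\<^sup>2)"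
proof -
  show "integrable M (\<lambda>\<omega>. grad F (x r \<omega>) $ k * grad (f j) (x r \<omega>) $ k)"
  proof (rule bounded_integrable[where c = "G * G"])
    show "\<bar>grad F y $ k * grad (f j) y $ k\<bar> \<le> G * G" for y
      unfolding abs_mult using grad_nth_bound G_nonneg by (intro mult_mono) auto
  qed measurable
  show "integrable M (\<lambda>\<omega>. (grad F (x r \<omega>) $ k)\<^sup>2)"
  proof (rule bounded_integrable[where c = "G * G"])
    show "\<bar>(grad F y $ k)\<^sup>2\<bar> \<le> G * G" for y
      unfolding power2_eq_square abs_mult using grad_nth_bound G_nonneg by (intro mult_mono) auto
  qed measurable
qed

text \<open>
  On the left of the pathwise bound the stale term \<open>a(s) w z\<^sub>k\<close> and \<open>- a(s) b(s)\<close> cancel in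
  expectation.
\<close>

lemma cross_term_expectation:
  assumes s: "t - B \<le> s" "s \<le> t"
  shows "expectation (\<lambda>\<omega>. grad F (x t \<omega>) $ k * grad (f j) (x t \<omega>) $ k)
      - expectation (\<lambda>\<omega>. (grad F (x t \<omega>) $ k)\<^sup>2) / 2 - L\<^sup>2 * (u s)\<^sup>2 / 2 * moment_bound
      - real CARD('d) * G\<^sup>2 * L * step_sum t * (3 * window_bound)
      \<le> expectation (\<lambda>\<omega>. grad F (x t \<omega>) $ k * (D j s \<omega> * z s \<omega> $ k))"
proof -
  let ?V = "window (2 * B) t" and ?c = "real CARD('d) * G\<^sup>2 * L * step_sum t"
  let ?a = "\<lambda>r \<omega>. grad F (x r \<omega>) $ k" and ?b = "\<lambda>r \<omega>. grad (f j) (x r \<omega>) $ k"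
  let ?m = "\<lambda>\<omega>. ?a s \<omega> * inner (grad (f j) (x s \<omega>)) (z s \<omega>) * z s \<omega> $ k"
  have c: "0 \<le> ?c" using L_nonneg step_sum_nonneg by simp
  have main: "integrable M ?m" "expectation ?m = expectation (\<lambda>\<omega>. ?a s \<omega> * ?b s \<omega>)"
    using expectation_directional[of "\<lambda>y. grad F y $ k" G "grad (f j)" G s k] grad_nth_bound grad_bound
    by simp_all
  note int = main(1) grad_products_integrable norm_z_sixth_moment(1) window_2B_moments(1,2)
  have "expectation (\<lambda>\<omega>. ?m \<omega> + ?a t \<omega> * ?b t \<omega> - ?a s \<omega> * ?b s \<omega> - (?a t \<omega>)\<^sup>2 / 2
          - L\<^sup>2 * (u s)\<^sup>2 / 2 * (1 + norm (z s \<omega>) ^ 6) - ?c * ((?V \<omega>)\<^sup>2 + 2 * ?V \<omega>))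
      \<le> expectation (\<lambda>\<omega>. ?a t \<omega> * (D j s \<omega> * z s \<omega> $ k))"
    by (intro integral_mono cross_term_pathwise s cross_term_integrable Bochner_Integration.integrable_diff
        Bochner_Integration.integrable_add integrable_mult_right integrable_divide int)
  also have "expectation (\<lambda>\<omega>. ?m \<omega> + ?a t \<omega> * ?b t \<omega> - ?a s \<omega> * ?b s \<omega> - (?a t \<omega>)\<^sup>2 / 2
          - L\<^sup>2 * (u s)\<^sup>2 / 2 * (1 + norm (z s \<omega>) ^ 6) - ?c * ((?V \<omega>)\<^sup>2 + 2 * ?V \<omega>))
      = expectation ?m + expectation (\<lambda>\<omega>. ?a t \<omega> * ?b t \<omega>) - expectation (\<lambda>\<omega>. ?a s \<omega> * ?b s \<omega>)
        - expectation (\<lambda>\<omega>. (?a t \<omega>)\<^sup>2) / 2 - L\<^sup>2 * (u s)\<^sup>2 / 2 * expectation (\<lambda>\<omega>. 1 + norm (z s \<omega>) ^ 6)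
        - ?c * (expectation (\<lambda>\<omega>. (?V \<omega>)\<^sup>2) + 2 * expectation ?V)"
    using int
    by (simp only: Bochner_Integration.integral_diff Bochner_Integration.integral_add
        Bochner_Integration.integrable_diff Bochner_Integration.integrable_add
        integrable_mult_right integrable_divide integral_mult_right_zero integral_divide_zero simp_thms)
  finally have "expectation (\<lambda>\<omega>. ?a t \<omega> * ?b t \<omega>) - expectation (\<lambda>\<omega>. (?a t \<omega>)\<^sup>2) / 2
        - L\<^sup>2 * (u s)\<^sup>2 / 2 * expectation (\<lambda>\<omega>. 1 + norm (z s \<omega>) ^ 6)
        - ?c * (expectation (\<lambda>\<omega>. (?V \<omega>)\<^sup>2) + 2 * expectation ?V)
      \<le> expectation (\<lambda>\<omega>. ?a t \<omega> * (D j s \<omega> * z s \<omega> $ k))"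
    unfolding main(2) by simp
  moreover have "L\<^sup>2 * (u s)\<^sup>2 / 2 * expectation (\<lambda>\<omega>. 1 + norm (z s \<omega>) ^ 6) \<le> L\<^sup>2 * (u s)\<^sup>2 / 2 * moment_bound"
    by (intro mult_left_mono norm_z_sixth_moment(2)) auto
  moreover have "?c * (expectation (\<lambda>\<omega>. (?V \<omega>)\<^sup>2) + 2 * expectation ?V) \<le> ?c * (3 * window_bound)"
    using window_2B_moments(3,4)[of t] by (intro mult_left_mono c) linarith
  ultimately show ?thesis by linarith
qed

definition bias_sum :: "nat \<Rightarrow> real" where "bias_sum t = (\<Sum>q = t - B..t. (u q)\<^sup>2)"

lemma inner_grad_estimate:
  assumes "B \<le> t"
  shows "inner (grad F (x t \<omega>)) (estimate t \<omega>) = (\<Sum>k\<in>UNIV. (1 / real CARD('n)) *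
    (\<Sum>j\<in>UNIV. grad F (x t \<omega>) $ k * (D j (nat (\<tau> (own k) j t)) \<omega> * z (nat (\<tau> (own k) j t)) \<omega> $ k)))"
proof -
  have "{j. 0 \<le> \<tau> i j t} = UNIV" for i
  proof -
    have "0 \<le> \<tau> i j t" for j using delay[of t i j] assms by linarith
    then show ?thesis by auto
  qed
  then show ?thesis by (simp add: inner_vec_def grad_estimate_def sum_distrib_left mult_ac)
qed

text \<open>
  Averaging \<open>\<partial>\<^sub>kF \<partial>\<^sub>kf\<^sub>j\<close> over \<open>j\<close> gives \<open>(\<partial>\<^sub>kF)\<^sup>2\<close>, of which Young's inequality has used up one half.
  From time \<open>B\<close> on every agent has heard from every other one, so that no \<open>j\<close> is missing from the
  average.
\<close>

lemma expected_alignment: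
  assumes t: "B \<le> t"
  defines "E \<equiv> expectation (\<lambda>\<omega>. (norm (grad F (x t \<omega>)))\<^sup>2)"
  shows "integrable M (\<lambda>\<omega>. inner (grad F (x t \<omega>)) (estimate t \<omega>))"
    and "E / 2 - real CARD('d) * (L\<^sup>2 * bias_sum t / 2 * moment_bound
            + real CARD('d) * G\<^sup>2 * L * step_sum t * (3 * window_bound))
         \<le> expectation (\<lambda>\<omega>. inner (grad F (x t \<omega>)) (estimate t \<omega>))"
proof -
  let ?n = "real CARD('n)"
  let ?s = "\<lambda>k j. nat (\<tau> (own k) j t)"
  let ?c = "\<lambda>k j \<omega>. grad F (x t \<omega>) $ k * (D j (?s k j) \<omega> * z (?s k j) \<omega> $ k)"
  define err where "err = L\<^sup>2 * bias_sum t / 2 * moment_bound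
      + real CARD('d) * G\<^sup>2 * L * step_sum t * (3 * window_bound)"
  have s: "t - B \<le> ?s k j" "?s k j \<le> t" for k j
    using stamp_in_window[of "own k" j t] delay[of t "own k" j] t by auto
  show "integrable M (\<lambda>\<omega>. inner (grad F (x t \<omega>)) (estimate t \<omega>))"
    unfolding inner_grad_estimate[OF t]
    by (intro Bochner_Integration.integrable_sum integrable_mult_right cross_term_integrable)
  have E: "E = (\<Sum>k\<in>UNIV. expectation (\<lambda>\<omega>. (grad F (x t \<omega>) $ k)\<^sup>2))"
    unfolding E_def power2_norm_eq_inner inner_vec_def inner_real_def power2_eq_square[symmetric]
    by (rule Bochner_Integration.integral_sum[OF grad_products_integrable(2)])
  have "E / 2 - real CARD('d) * err
      = (\<Sum>k\<in>UNIV. expectation (\<lambda>\<omega>. (grad F (x t \<omega>) $ k)\<^sup>2) / 2 - err)"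
    by (simp add: E sum_subtractf sum_divide_distrib)
  also have "\<dots> \<le> (\<Sum>k\<in>UNIV. (1 / ?n) * (\<Sum>j\<in>UNIV. expectation (?c k j)))"
  proof (rule sum_mono)
    fix k
    let ?E = "expectation (\<lambda>\<omega>. (grad F (x t \<omega>) $ k)\<^sup>2)"
    let ?P = "\<lambda>j. expectation (\<lambda>\<omega>. grad F (x t \<omega>) $ k * grad (f j) (x t \<omega>) $ k)"
    have "?E = expectation (\<lambda>\<omega>. (1 / ?n) * (\<Sum>j\<in>UNIV. grad F (x t \<omega>) $ k * grad (f j) (x t \<omega>) $ k))"
      by (intro arg_cong[where f = expectation] ext, subst sum_distrib_left[symmetric])
         (simp add: grad_F_nth power2_eq_square)
    also have "\<dots> = (1 / ?n) * (\<Sum>j\<in>UNIV. ?P j)"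
      by (simp only: integral_mult_right_zero Bochner_Integration.integral_sum[OF grad_products_integrable(1)])
    finally have avg: "?E = (1 / ?n) * (\<Sum>j\<in>UNIV. ?P j)" .
    have "?P j - ?E / 2 - err \<le> expectation (?c k j)" for j
    proof -
      have "(u (?s k j))\<^sup>2 \<le> bias_sum t"
        unfolding bias_sum_def using s by (intro member_le_sum) auto
      then have "L\<^sup>2 * (u (?s k j))\<^sup>2 / 2 * moment_bound \<le> L\<^sup>2 * bias_sum t / 2 * moment_bound"
        using moment_bound_ge_1 by (intro mult_right_mono divide_right_mono mult_left_mono) auto
      with cross_term_expectation[OF s, of k j k j] show ?thesis unfolding err_def by linarith
    qed
    then have "(\<Sum>j\<in>UNIV. ?P j - ?E / 2 - err) \<le> (\<Sum>j\<in>UNIV. expectation (?c k j))" by (rule sum_mono)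
    then have "(1 / ?n) * ((\<Sum>j\<in>UNIV. ?P j) - ?n * (?E / 2 + err)) \<le> (1 / ?n) * (\<Sum>j\<in>UNIV. expectation (?c k j))"
      by (intro mult_left_mono) (simp_all add: sum_subtractf distrib_left)
    moreover have "(1 / ?n) * ((\<Sum>j\<in>UNIV. ?P j) - ?n * (?E / 2 + err)) = ?E / 2 - err"
      by (simp add: right_diff_distrib avg)
    ultimately show "?E / 2 - err \<le> (1 / ?n) * (\<Sum>j\<in>UNIV. expectation (?c k j))" by simp
  qed
  also have "\<dots> = expectation (\<lambda>\<omega>. inner (grad F (x t \<omega>)) (estimate t \<omega>))"
    unfolding inner_grad_estimate[OF t]
    by (simp only: Bochner_Integration.integral_sum integrable_mult_right integral_mult_right_zero
        cross_term_integrable Bochner_Integration.integrable_sum simp_thms)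
  finally show "E / 2 - real CARD('d) * (L\<^sup>2 * bias_sum t / 2 * moment_bound
            + real CARD('d) * G\<^sup>2 * L * step_sum t * (3 * window_bound))
         \<le> expectation (\<lambda>\<omega>. inner (grad F (x t \<omega>)) (estimate t \<omega>))" by (simp only: err_def)
qed

lemma estimate_bound_2B:
  assumes "\<omega> \<in> space M"
  shows "norm (estimate t \<omega>) \<le> real CARD('d) * G * window (2 * B) t \<omega>"
proof -
  have "real CARD('d) * G * window B t \<omega> \<le> real CARD('d) * G * window (2 * B) t \<omega>"
    using G_nonneg by (intro mult_left_mono window_mono) auto
  then show ?thesis using norm_estimate_le[OF assms, of t] by linarith
qed

lemma cost_integrable: "integrable M (\<lambda>\<omega>. F (x t \<omega>))"
proof (induction t)
  case 0
  have "integrable M (\<lambda>\<omega>. F (x 0 \<omega>)) \<longleftrightarrow> integrable M (\<lambda>\<omega>. F x\<^sub>0)"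
    by (rule Bochner_Integration.integrable_cong) (simp_all add: x_init)
  then show ?case by simp
next
  case (Suc t)
  let ?c = "G * (\<eta> t * (real CARD('d) * G))"
  show ?case
  proof (rule Bochner_Integration.integrable_bound)
    show "integrable M (\<lambda>\<omega>. \<bar>F (x t \<omega>)\<bar> + ?c * window (2 * B) t \<omega>)"
      using Suc window_2B_moments(1)
      by (intro Bochner_Integration.integrable_add integrable_mult_right integrable_abs)
    have "\<bar>F (x (Suc t) \<omega>)\<bar> \<le> \<bar>F (x t \<omega>)\<bar> + ?c * window (2 * B) t \<omega>" if "\<omega> \<in> space M" for \<omega>
    proof -
      have "\<bar>F (x (Suc t) \<omega>) - F (x t \<omega>)\<bar> \<le> G * (\<eta> t * norm (estimate t \<omega>))"
        using lipschitz_onD[OF F_lipschitz, of "x (Suc t) \<omega>" "x t \<omega>"] \<eta>_nonneg[of t]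
        by (simp add: dist_norm x_step[OF that])
      also have "\<dots> \<le> G * (\<eta> t * (real CARD('d) * G * window (2 * B) t \<omega>))"
        using estimate_bound_2B[OF that] G_nonneg \<eta>_nonneg by (intro mult_left_mono) auto
      finally show ?thesis by (simp add: mult.assoc)
    qed
    then show "AE \<omega> in M. norm (F (x (Suc t) \<omega>)) \<le> norm (\<bar>F (x t \<omega>)\<bar> + ?c * window (2 * B) t \<omega>)"
      using abs_ge_self order_trans by (intro AE_I2) (simp only: real_norm_def, blast)
  qed measurable
qed

text \<open>
  The descent inequality of a smooth function, with the alignment bounded from below and the
  second-order term \<open>L \<eta>(t)\<^sup>2 \<parallel>g(t)\<parallel>\<^sup>2\<close> bounded by means of \<open>\<eta>(t) \<le> step_sum t\<close>.  After doubling,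
  which clears the half left over from the alignment, the drift contributes \<open>2 \<cdot> 3\<close> and the second-order
  term \<open>2\<close> to the coefficient \<open>8\<close>.
\<close>

theorem expected_descent:
  assumes t: "B \<le> t"
  defines "C \<equiv> 8 * real CARD('d) ^ 2 * G\<^sup>2 * L * window_bound + real CARD('d) * L\<^sup>2 * moment_bound"
  shows "\<eta> t * expectation (\<lambda>\<omega>. (norm (grad F (x t \<omega>)))\<^sup>2)
    \<le> 2 * (expectation (\<lambda>\<omega>. F (x t \<omega>)) - expectation (\<lambda>\<omega>. F (x (Suc t) \<omega>)))
      + C * \<eta> t * (step_sum t + bias_sum t)"
proof -
  let ?N = "real CARD('d)" and ?V = "window (2 * B) t"
  let ?I = "\<lambda>\<omega>. inner (grad F (x t \<omega>)) (estimate t \<omega>)"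
  let ?E = "expectation (\<lambda>\<omega>. (norm (grad F (x t \<omega>)))\<^sup>2)"
  have path: "F (x (Suc t) \<omega>) \<le> F (x t \<omega>) - \<eta> t * ?I \<omega> + L * (\<eta> t)\<^sup>2 * (?N * G)\<^sup>2 * (?V \<omega>)\<^sup>2"
    if "\<omega> \<in> space M" for \<omega>
  proof -
    have "F (x (Suc t) \<omega>) - F (x t \<omega>) + \<eta> t * ?I \<omega> \<le> L * ((\<eta> t)\<^sup>2 * (norm (estimate t \<omega>))\<^sup>2)"
      using lsmooth_first_order[OF F_smooth, of "x (Suc t) \<omega>" "x t \<omega>"]
      by (simp add: x_step[OF that] power_mult_distrib)
    also have "\<dots> \<le> L * ((\<eta> t)\<^sup>2 * (?N * G * ?V \<omega>)\<^sup>2)"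
      using estimate_bound_2B[OF that] L_nonneg by (intro mult_left_mono power_mono) auto
    finally show ?thesis by (simp add: power_mult_distrib mult_ac)
  qed
  note int = cost_integrable expected_alignment(1)[OF t] window_2B_moments(2)
  have "expectation (\<lambda>\<omega>. F (x (Suc t) \<omega>))
      \<le> expectation (\<lambda>\<omega>. F (x t \<omega>) - \<eta> t * ?I \<omega> + L * (\<eta> t)\<^sup>2 * (?N * G)\<^sup>2 * (?V \<omega>)\<^sup>2)"
    by (intro integral_mono path int Bochner_Integration.integrable_diff
        Bochner_Integration.integrable_add integrable_mult_right)
  also have "\<dots> = expectation (\<lambda>\<omega>. F (x t \<omega>)) - \<eta> t * expectation ?I
      + L * (\<eta> t)\<^sup>2 * (?N * G)\<^sup>2 * expectation (\<lambda>\<omega>. (?V \<omega>)\<^sup>2)"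
    using int
    by (simp only: Bochner_Integration.integral_diff Bochner_Integration.integral_add
        Bochner_Integration.integrable_diff integrable_mult_right integral_mult_right_zero simp_thms)
  also have "L * (\<eta> t)\<^sup>2 * (?N * G)\<^sup>2 * expectation (\<lambda>\<omega>. (?V \<omega>)\<^sup>2)
      \<le> L * (\<eta> t * step_sum t) * (?N * G)\<^sup>2 * window_bound"
    unfolding power2_eq_square[of "\<eta> t"] using window_2B_moments(4)[of t] L_nonneg \<eta>_nonneg eta_le_step_sum step_sum_nonneg
    by (intro mult_mono mult_nonneg_nonneg) auto
  finally have "expectation (\<lambda>\<omega>. F (x (Suc t) \<omega>)) \<le> expectation (\<lambda>\<omega>. F (x t \<omega>)) - \<eta> t * expectation ?I
      + L * (\<eta> t * step_sum t) * (?N * G)\<^sup>2 * window_bound" by simp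
  moreover have "\<eta> t * (?E / 2 - ?N * (L\<^sup>2 * bias_sum t / 2 * moment_bound
        + ?N * G\<^sup>2 * L * step_sum t * (3 * window_bound))) \<le> \<eta> t * expectation ?I"
    by (intro mult_left_mono expected_alignment(2) t \<eta>_nonneg)
  ultimately have "\<eta> t * ?E \<le> 2 * (expectation (\<lambda>\<omega>. F (x t \<omega>)) - expectation (\<lambda>\<omega>. F (x (Suc t) \<omega>)))
      + 2 * \<eta> t * (?N * (L\<^sup>2 * bias_sum t / 2 * moment_bound + ?N * G\<^sup>2 * L * step_sum t * (3 * window_bound)))
      + 2 * (L * (\<eta> t * step_sum t) * (?N * G)\<^sup>2 * window_bound)"
    by (simp add: right_diff_distrib)
  also have "\<dots> = 2 * (expectation (\<lambda>\<omega>. F (x t \<omega>)) - expectation (\<lambda>\<omega>. F (x (Suc t) \<omega>)))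
      + (8 * ?N ^ 2 * G\<^sup>2 * L * window_bound * \<eta> t * step_sum t + ?N * L\<^sup>2 * moment_bound * \<eta> t * bias_sum t)"
    by (simp add: power2_eq_square algebra_simps)
  also have "8 * ?N ^ 2 * G\<^sup>2 * L * window_bound * \<eta> t * step_sum t + ?N * L\<^sup>2 * moment_bound * \<eta> t * bias_sum t
      \<le> C * \<eta> t * step_sum t + C * \<eta> t * bias_sum t"
  proof (intro add_mono mult_right_mono)
    have "0 \<le> window_bound" "0 \<le> moment_bound" unfolding window_bound_def using moment_bound_ge_1 by auto
    then show "8 * ?N ^ 2 * G\<^sup>2 * L * window_bound \<le> C" "?N * L\<^sup>2 * moment_bound \<le> C"
      unfolding C_def using L_nonneg by auto
    show "0 \<le> bias_sum t" unfolding bias_sum_def by (intro sum_nonneg) auto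
  qed (use \<eta>_nonneg step_sum_nonneg in auto)
  finally show ?thesis by (simp add: distrib_left)
qed

end

section \<open>From descent to decay of averages\<close>

text \<open>
  Comparison with the integral of \<open>s\<^sup>-\<^sup>p\<close>, one unit interval at a time.
\<close>

lemma sum_powr_le:
  assumes p: "0 < p" "p < 1"
  shows "(\<Sum>t = 0..T. (real t + 1) powr (-p)) \<le> (real T + 1) powr (1 - p) / (1 - p)"
proof (induction T)
  case 0
  then show ?case using p by simp
next
  case (Suc T)
  let ?a = "real T + 1" and ?b = "real T + 2"
  have "\<exists>s>?a. s < ?b \<and> ?b powr (1 - p) / (1 - p) - ?a powr (1 - p) / (1 - p) = (?b - ?a) * s powr (-p)"
  proof (rule MVT2)
    fix s assume "?a \<le> s" "s \<le> ?b"
    then show "((\<lambda>s. s powr (1 - p) / (1 - p)) has_real_derivative s powr (-p)) (at s)"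
      using p by (auto intro!: derivative_eq_intros)
  qed simp
  then obtain s where s: "?a < s" "s < ?b"
    and eq: "?b powr (1 - p) / (1 - p) - ?a powr (1 - p) / (1 - p) = s powr (-p)" by auto
  have "?b powr (-p) \<le> s powr (-p)" using s p by (intro powr_mono2') auto
  with Suc.IH eq show ?case by (simp add: add.commute)
qed

text \<open>
  Summation by parts in inductive form.  The numbers \<open>a t\<close> may increase, so they are compared with a
  monotone majorant \<open>A\<close>: replacing the weight \<open>1 / \<eta> T\<close> by the larger \<open>1 / \<eta> (T + 1)\<close> is harmless
  because it multiplies the nonnegative number \<open>A (T + 1) - a (T + 1)\<close>.
\<close>

lemma weighted_telescope_le:
  fixes a A \<eta> :: "nat \<Rightarrow> real"
  assumes \<eta>: "\<And>t. \<eta> t > 0" "antimono \<eta>" and A: "\<And>t. a t \<le> A t" "mono A"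
  shows "(\<Sum>t = 0..T. (a t - a (Suc t)) / \<eta> t) \<le> (A (Suc T) - a (Suc T)) / \<eta> T"
proof (induction T)
  case 0
  have "a 0 - a 1 \<le> A 1 - a 1" using A(1)[of 0] monoD[OF A(2), of 0 1] by simp
  then show ?case using \<eta>(1)[of 0] by (simp add: divide_right_mono less_imp_le)
next
  case (Suc T)
  have "(A (Suc T) - a (Suc T)) / \<eta> T \<le> (A (Suc T) - a (Suc T)) / \<eta> (Suc T)"
    using A(1)[of "Suc T"] \<eta>(1)[of "Suc T"] antimonoD[OF \<eta>(2), of T "Suc T"]
    by (intro divide_left_mono) auto
  with Suc.IH have "(\<Sum>t = 0..Suc T. (a t - a (Suc t)) / \<eta> t)
      \<le> (A (Suc T) - a (Suc T)) / \<eta> (Suc T) + (a (Suc T) - a (Suc (Suc T))) / \<eta> (Suc T)"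
    by simp
  also have "\<dots> = (A (Suc T) - a (Suc (Suc T))) / \<eta> (Suc T)"
    by (simp add: add_divide_distrib[symmetric])
  also have "\<dots> \<le> (A (Suc (Suc T)) - a (Suc (Suc T))) / \<eta> (Suc T)"
    using monoD[OF A(2), of "Suc T" "Suc (Suc T)"] \<eta>(1)[of "Suc T"]
    by (intro divide_right_mono) (auto intro: less_imp_le)
  finally show ?case .
qed

text \<open>
  Here \<open>a\<close> is the excess cost and \<open>e\<close> the squared gradient.  The descent inequality serves twice.
  Dropping \<open>e\<close> it bounds the growth of \<open>a\<close> by the partial sums of \<open>\<eta>(t) (t+1)\<^sup>-\<^sup>\<gamma>\<close>, which are of
  order \<open>T\<^sup>1\<^sup>-\<^sup>\<alpha>\<^sup>-\<^sup>\<gamma>\<close>; this is the majorant \<open>A\<close>.  Divided by \<open>\<eta>(t)\<close> it bounds the sum of \<open>e\<close>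
  by \<open>A / \<eta>(T)\<close> and the sum of \<open>(t+1)\<^sup>-\<^sup>\<gamma>\<close>, both of order \<open>T\<^sup>1\<^sup>-\<^sup>\<gamma>\<close>.
\<close>

lemma average_rate_of_descent:
  fixes a e :: "nat \<Rightarrow> real" and \<eta>\<^sub>0 \<alpha> \<gamma> C :: real
  defines "\<eta> \<equiv> \<lambda>t. \<eta>\<^sub>0 / (real t + 1) powr \<alpha>"
  assumes \<eta>0: "\<eta>\<^sub>0 > 0" and \<alpha>: "\<alpha> > 0" and \<gamma>: "0 < \<gamma>" "\<alpha> + \<gamma> < 1"
    and C: "C \<ge> 0"
    and a: "\<And>t. 0 \<le> a t" and e: "\<And>t. 0 \<le> e t"
    and descent: "\<And>t. \<eta> t * e t \<le> 2 * (a t - a (Suc t)) + C * \<eta> t * (real t + 1) powr (-\<gamma>)"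
  shows "\<exists>K. \<forall>T. (1 / (real T + 1)) * (\<Sum>t = 0..T. e t) \<le> K * (real T + 1) powr (-\<gamma>)"
proof -
  let ?p = "\<alpha> + \<gamma>"
  have pos: "\<eta> t > 0" for t using \<eta>0 by (simp add: \<eta>_def)
  have anti: "antimono \<eta>" unfolding \<eta>_def
    using \<eta>0 \<alpha> by (intro antimonoI divide_left_mono powr_mono2) auto
  have \<eta>\<gamma>: "\<eta> t * (real t + 1) powr (-\<gamma>) = \<eta>\<^sub>0 * (real t + 1) powr (-?p)" for t
    by (simp add: \<eta>_def powr_minus_divide powr_diff)
  define A where "A n = a 0 + (C * \<eta>\<^sub>0 / 2) * (\<Sum>s<n. (real s + 1) powr (-?p))" for n
  have "mono A" unfolding A_def using C \<eta>0
    by (intro monoI add_left_mono mult_left_mono sum_mono2) auto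
  have aA: "a t \<le> A t" for t
  proof (induction t)
    case 0
    then show ?case by (simp add: A_def)
  next
    case (Suc t)
    have "2 * a (Suc t) \<le> 2 * a t + C * (\<eta> t * (real t + 1) powr (-\<gamma>))"
      using descent[of t] mult_nonneg_nonneg[OF less_imp_le[OF pos] e, of t t] by (simp add: mult_ac)
    then have "a (Suc t) \<le> a t + C * \<eta>\<^sub>0 / 2 * (real t + 1) powr (-?p)"
      unfolding \<eta>\<gamma> by simp
    with Suc.IH show ?case by (simp add: A_def distrib_left)
  qed
  have A_bound: "A (Suc T) \<le> a 0 + (C * \<eta>\<^sub>0 / 2) * ((real T + 1) powr (1 - ?p) / (1 - ?p))" for T
    unfolding A_def lessThan_Suc_atMost atLeast0AtMost[symmetric]
    using sum_powr_le[of ?p T] \<alpha> \<gamma> C \<eta>0 by (intro add_left_mono mult_left_mono) auto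
  define K where "K = 2 * (a 0 / \<eta>\<^sub>0 + C / 2 / (1 - ?p)) + C / (1 - \<gamma>)"
  have "(1 / (real T + 1)) * (\<Sum>t = 0..T. e t) \<le> K * (real T + 1) powr (-\<gamma>)" for T
  proof -
    let ?N = "real T + 1"
    have N: "?N \<ge> 1" by simp
    have "e t \<le> 2 * ((a t - a (Suc t)) / \<eta> t) + C * (real t + 1) powr (-\<gamma>)" for t
      using descent[of t] pos[of t] by (simp add: field_simps)
    then have "(\<Sum>t = 0..T. e t) \<le> 2 * (\<Sum>t = 0..T. (a t - a (Suc t)) / \<eta> t)
        + C * (\<Sum>t = 0..T. (real t + 1) powr (-\<gamma>))"
      by (subst (1 2) sum_distrib_left, subst sum.distrib[symmetric], intro sum_mono)
    also have "(\<Sum>t = 0..T. (a t - a (Suc t)) / \<eta> t) \<le> A (Suc T) / \<eta> T"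
      using weighted_telescope_le[OF pos anti aA \<open>mono A\<close>, of T] a[of "Suc T"] pos[of T]
      by (smt (verit) divide_right_mono)
    also have "\<dots> \<le> (a 0 + (C * \<eta>\<^sub>0 / 2) * (?N powr (1 - ?p) / (1 - ?p))) / \<eta> T"
      using A_bound[of T] pos[of T] by (intro divide_right_mono) auto
    also have "\<dots> = a 0 / \<eta>\<^sub>0 * ?N powr \<alpha> + C / 2 / (1 - ?p) * ?N powr (1 - \<gamma>)"
    proof -
      have "?N powr (1 - ?p) * ?N powr \<alpha> = ?N powr (1 - \<gamma>)" by (simp add: powr_add[symmetric])
      then show ?thesis using \<eta>0 \<gamma> by (simp add: \<eta>_def field_simps)
    qed
    also have "a 0 / \<eta>\<^sub>0 * ?N powr \<alpha> \<le> a 0 / \<eta>\<^sub>0 * ?N powr (1 - \<gamma>)"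
      using \<gamma> a[of 0] \<eta>0 by (intro mult_left_mono powr_mono) auto
    also have "C * (\<Sum>t = 0..T. (real t + 1) powr (-\<gamma>)) \<le> C * (?N powr (1 - \<gamma>) / (1 - \<gamma>))"
      using sum_powr_le[of \<gamma> T] \<alpha> \<gamma> C by (intro mult_left_mono) auto
    finally have "(\<Sum>t = 0..T. e t) \<le> 2 * (a 0 / \<eta>\<^sub>0 * ?N powr (1 - \<gamma>) + C / 2 / (1 - ?p) * ?N powr (1 - \<gamma>))
        + C * (?N powr (1 - \<gamma>) / (1 - \<gamma>))" by simp
    also have "\<dots> = K * ?N powr (1 - \<gamma>)" 
      unfolding K_def by (simp only: ring_distribs divide_inverse mult_ac)
    also have "?N powr (1 - \<gamma>) = ?N * ?N powr (-\<gamma>)" using N by (simp add: powr_diff powr_minus_divide)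
    finally show ?thesis using N by (simp add: field_simps)
  qed
  then show ?thesis by blast
qed

section \<open>Rates for polynomial step sizes\<close>

text \<open>
  Inside a window of bounded length a polynomial weight varies by a bounded factor, since
  \<open>t + 1 \<le> (B + 1) (q + 1)\<close>.
\<close>

lemma powr_window_le:
  assumes "t \<le> q + B" "0 < \<gamma>"
  shows "(real q + 1) powr (-\<gamma>) \<le> (real B + 1) powr \<gamma> * (real t + 1) powr (-\<gamma>)"
proof -
  have "t + 1 \<le> (B + 1) * (q + 1)" using assms(1) by (simp add: algebra_simps)
  then have "real t + 1 \<le> (real B + 1) * (real q + 1)"
    unfolding of_nat_1[symmetric, where ?'a = real] of_nat_add[symmetric] of_nat_mult[symmetric] of_nat_le_iff .
  then have "(real t + 1) powr \<gamma> \<le> ((real B + 1) * (real q + 1)) powr \<gamma>"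
    using assms(2) by (intro powr_mono2) auto
  also have "\<dots> = (real B + 1) powr \<gamma> * (real q + 1) powr \<gamma>" by (rule powr_mult)
  finally show ?thesis by (simp add: powr_minus_divide divide_le_eq mult.commute)
qed

text \<open>
  The window sums of \<open>\<eta>\<close> and \<open>u\<^sup>2\<close> are \<open>O((t+1)\<^sup>-\<^sup>\<gamma>)\<close> because \<open>\<gamma> \<le> \<alpha>\<close> and
  \<open>\<gamma> \<le> 2\<beta>\<close>, so the expected descent has the form required by \<open>average_rate_of_descent\<close>.
\<close>

lemma (in delayed_two_point_descent) average_gradient_rate:
  assumes below: "bdd_below (range F)"
    and \<eta>: "\<And>t. \<eta> t = \<eta>\<^sub>0 / (real t + 1) powr \<alpha>" and u: "\<And>t. u t = u\<^sub>0 / (real t + 1) powr \<beta>"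
    and \<eta>0: "\<eta>\<^sub>0 > 0" and \<alpha>: "\<alpha> > 0" and \<gamma>: "0 < \<gamma>" "\<gamma> \<le> \<alpha>" "\<gamma> \<le> 2 * \<beta>" "\<alpha> + \<gamma> < 1"
  shows "\<exists>K. \<forall>T. 1 / (real T + 1) * (\<Sum>t = 0..T. expectation (\<lambda>\<omega>. (norm (grad F (x t \<omega>)))\<^sup>2))
           \<le> K * (real T + 1) powr (-\<gamma>)"
proof -
  define e where "e t = expectation (\<lambda>\<omega>. (norm (grad F (x t \<omega>)))\<^sup>2)" for t
  obtain m where m: "m \<le> F y" for y using below by (auto simp: bdd_below_def)
  define a where "a t = expectation (\<lambda>\<omega>. F (x t \<omega>)) - m" for t
  have a: "0 \<le> a t" for t
  proof -
    have "expectation (\<lambda>\<omega>. m) \<le> expectation (\<lambda>\<omega>. F (x t \<omega>))"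
      by (intro integral_mono m cost_integrable) simp
    then show ?thesis by (simp add: a_def prob_space)
  qed
  have e: "0 \<le> e t" for t unfolding e_def by (intro Bochner_Integration.integral_nonneg) simp
  define C where "C = 8 * real CARD('d) ^ 2 * G\<^sup>2 * L * window_bound + real CARD('d) * L\<^sup>2 * moment_bound"
  have C: "0 \<le> C" using L_nonneg moment_bound_ge_1 by (auto simp: C_def window_bound_def)
  define C' where "C' = (real B + 1) * ((\<eta>\<^sub>0 + u\<^sub>0\<^sup>2) * (real B + 1) powr \<gamma>)"
  have errors: "step_sum t + bias_sum t \<le> C' * (real t + 1) powr (-\<gamma>)" for t
  proof -
    have "\<eta> q + (u q)\<^sup>2 \<le> (\<eta>\<^sub>0 + u\<^sub>0\<^sup>2) * (real q + 1) powr (-\<gamma>)" for q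
    proof -
      have "\<eta> q = \<eta>\<^sub>0 * (real q + 1) powr (-\<alpha>)" by (simp add: \<eta> powr_minus_divide)
      moreover have "(u q)\<^sup>2 = u\<^sub>0\<^sup>2 * (real q + 1) powr (-(2 * \<beta>))"
        by (simp add: u power_divide powr_minus_divide powr_power mult.commute)
      moreover have "(real q + 1) powr (-\<alpha>) \<le> (real q + 1) powr (-\<gamma>)"
        "(real q + 1) powr (-(2 * \<beta>)) \<le> (real q + 1) powr (-\<gamma>)"
        using \<gamma> by (intro powr_mono; simp)+
      ultimately show ?thesis using \<eta>0 by (simp add: distrib_right add_mono mult_left_mono)
    qed
    then have "step_sum t + bias_sum t \<le> (\<Sum>q = t - B..t. (\<eta>\<^sub>0 + u\<^sub>0\<^sup>2) * (real q + 1) powr (-\<gamma>))"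
      unfolding step_sum_def bias_sum_def sum.distrib[symmetric] by (intro sum_mono)
    also have "\<dots> \<le> (\<Sum>q = t - B..t. (\<eta>\<^sub>0 + u\<^sub>0\<^sup>2) * ((real B + 1) powr \<gamma> * (real t + 1) powr (-\<gamma>)))"
      using \<eta>0 \<gamma>(1) by (intro sum_mono mult_left_mono powr_window_le) auto
    also have "\<dots> \<le> (real B + 1) * ((\<eta>\<^sub>0 + u\<^sub>0\<^sup>2) * ((real B + 1) powr \<gamma> * (real t + 1) powr (-\<gamma>)))"
      unfolding sum_constant using \<eta>0 by (intro mult_right_mono) auto
    finally show ?thesis by (simp add: C'_def mult.assoc)
  qed
  \<comment> \<open>The finitely many times before \<open>B\<close>, where messages may be missing, are paid for by enlarging the constant.\<close>
  define r where "r t = \<bar>\<eta> t * e t - 2 * (a t - a (Suc t))\<bar> / (\<eta> t * (real t + 1) powr (-\<gamma>))" for t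
  have pos: "0 < \<eta> t * (real t + 1) powr (-\<gamma>)" for t using \<eta>0 by (simp add: \<eta>)
  have r: "0 \<le> r t" for t unfolding r_def using pos[of t] by (intro divide_nonneg_pos) auto
  have "\<eta> t * e t \<le> 2 * (a t - a (Suc t)) + (C * C' + sum r {..<B}) * \<eta> t * (real t + 1) powr (-\<gamma>)" for t
  proof (cases "B \<le> t")
    case True
    have "\<eta> t * e t \<le> 2 * (a t - a (Suc t)) + C * \<eta> t * (step_sum t + bias_sum t)"
      using expected_descent[OF True] by (simp add: e_def a_def C_def)
    also have "C * \<eta> t * (step_sum t + bias_sum t) \<le> C * \<eta> t * (C' * (real t + 1) powr (-\<gamma>))"
      using C \<eta>_nonneg by (intro mult_left_mono errors) auto
    also have "\<dots> = C * C' * (\<eta> t * (real t + 1) powr (-\<gamma>))" by (simp only: mult_ac)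
    also have "\<dots> \<le> (C * C' + sum r {..<B}) * (\<eta> t * (real t + 1) powr (-\<gamma>))"
      using pos[of t] r by (intro mult_right_mono) (auto intro: sum_nonneg)
    finally show ?thesis by (simp add: mult.assoc)
  next
    case False
    have "\<eta> t * e t - 2 * (a t - a (Suc t)) \<le> r t * (\<eta> t * (real t + 1) powr (-\<gamma>))"
      unfolding iffD1[OF nonzero_eq_divide_eq[OF less_imp_neq[OF pos, symmetric]] r_def] by (rule abs_ge_self)
    also have "\<dots> \<le> (C * C' + sum r {..<B}) * (\<eta> t * (real t + 1) powr (-\<gamma>))"
    proof (intro mult_right_mono)
      have "0 \<le> C'" unfolding C'_def using \<eta>0 by simp
      moreover have "r t \<le> sum r {..<B}" using False r by (intro member_le_sum) auto
      ultimately show "r t \<le> C * C' + sum r {..<B}" using C by (simp add: add_increasing)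
    qed (use pos[of t] in simp)
    finally show ?thesis by (simp add: mult.assoc)
  qed
  moreover have "0 \<le> C * C' + sum r {..<B}"
    using C r \<eta>0 by (auto simp: C'_def intro!: add_nonneg_nonneg sum_nonneg)
  ultimately have "\<exists>K. \<forall>T. (1 / (real T + 1)) * (\<Sum>t = 0..T. e t) \<le> K * (real T + 1) powr (-\<gamma>)"
    by (intro average_rate_of_descent[of \<eta>\<^sub>0 \<alpha> \<gamma> _ a e] \<eta>0 \<alpha> \<gamma> a e) (simp_all add: \<eta>)
  then show ?thesis by (simp only: e_def)
qed

theorem theorem1:
  fixes M :: "'w measure"
    and own :: "'d::finite \<Rightarrow> 'n::finite"
    and f :: "'n \<Rightarrow> real ^ 'd \<Rightarrow> real"
    and G L :: real
    and \<tau> :: "'n \<Rightarrow> 'n \<Rightarrow> nat \<Rightarrow> int"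
    and B :: nat
    and \<eta> u :: "nat \<Rightarrow> real"
    and \<eta>\<^sub>0 u\<^sub>0 \<alpha> \<beta> :: real
    and x\<^sub>0 :: "real ^ 'd"
    and z x :: "nat \<Rightarrow> 'w \<Rightarrow> real ^ 'd"
    and D :: "'n \<Rightarrow> nat \<Rightarrow> 'w \<Rightarrow> real"
  assumes prob: "prob_space M"
    and z_normal: "\<And>i t. distr M (PiM {k. own k = i} (\<lambda>_. borel)) (\<lambda>\<omega>. block own i (z t \<omega>))
                     = std_gaussian {k. own k = i}"
    and z_indep: "prob_space.indep_vars M (\<lambda>(i, t). PiM {k. own k = i} (\<lambda>_. borel))
                    (\<lambda>(i, t) \<omega>. block own i (z t \<omega>)) (UNIV :: ('n \<times> nat) set)"
    and f_below: "bdd_below (range (avg_cost f))"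
    and f_lipschitz: "\<And>i. G-lipschitz_on UNIV (f i)"
    and f_smooth: "\<And>i. lsmooth L (f i)"
    and \<tau>_ge: "\<And>i j t. \<tau> i j t \<ge> -1"
    and \<tau>_self: "\<And>i t. \<tau> i i t = int t"
    and \<tau>_mono: "\<And>i j. mono (\<tau> i j)"
    and \<tau>_delay: "\<And>i j t. 0 \<le> int t - \<tau> i j t \<and> int t - \<tau> i j t \<le> int B"
    and \<eta>: "\<And>t. \<eta> t = \<eta>\<^sub>0 / (real t + 1) powr \<alpha>"
    and u: "\<And>t. u t = u\<^sub>0 / (real t + 1) powr \<beta>"
    and params: "\<eta>\<^sub>0 > 0" "u\<^sub>0 > 0" "0 < \<alpha>" "\<alpha> < 1" "\<beta> > 0"
    and x_init: "\<And>\<omega>. \<omega> \<in> space M \<Longrightarrow> x 0 \<omega> = x\<^sub>0"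
    and D: "\<And>i t \<omega>. \<omega> \<in> space M \<Longrightarrow> D i t \<omega> = two_point_diff (f i) (u t) (x t \<omega>) (z t \<omega>)"
    and x_step: "\<And>t \<omega>. \<omega> \<in> space M \<Longrightarrow>
           x (Suc t) \<omega> = x t \<omega> - \<eta> t *\<^sub>R grad_estimate own \<tau> (\<lambda>j s. D j s \<omega>) (\<lambda>s. z s \<omega>) t"
  shows "((\<lambda>T. 1 / (real T + 1) *
            (\<Sum>t = 0..T. integral\<^sup>L M (\<lambda>\<omega>. (norm (grad (avg_cost f) (x t \<omega>)))\<^sup>2))) \<longlonglongrightarrow> 0)
    \<and> (\<alpha> = 1 / 2 \<and> \<beta> = 1 / 4 \<longrightarrow>
         (\<forall>\<epsilon>. 0 < \<epsilon> \<and> \<epsilon> < 1 / 2 \<longrightarrow>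
            (\<lambda>T. 1 / (real T + 1) *
               (\<Sum>t = 0..T. integral\<^sup>L M (\<lambda>\<omega>. (norm (grad (avg_cost f) (x t \<omega>)))\<^sup>2)))
            \<in> O(\<lambda>T. real T powr (-(1 / 2 - \<epsilon>)))))"
proof -
  interpret prob_space M by (rule prob)
  interpret delayed_two_point_descent M own z f G L \<tau> B \<eta> u x\<^sub>0 x D
    by unfold_locales
       (fact z_normal z_indep f_lipschitz f_smooth \<tau>_delay x_init D x_step | simp add: \<eta> u params less_imp_le)+
  define avg where "avg T = 1 / (real T + 1) *
      (\<Sum>t = 0..T. expectation (\<lambda>\<omega>. (norm (grad F (x t \<omega>)))\<^sup>2))" for T
  have avg_nonneg: "0 \<le> avg T" for T unfolding avg_def by (intro mult_nonneg_nonneg sum_nonneg Bochner_Integration.integral_nonneg) auto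
  have rate: "\<exists>K. \<forall>T. avg T \<le> K * (real T + 1) powr (-\<gamma>)"
    if "0 < \<gamma>" "\<gamma> \<le> \<alpha>" "\<gamma> \<le> 2 * \<beta>" "\<alpha> + \<gamma> < 1" for \<gamma>
    unfolding avg_def using average_gradient_rate[OF f_below \<eta> u params(1,3) that] .
  have "avg \<longlonglongrightarrow> 0"
  proof -
    \<comment> \<open>Halving \<open>1 - \<alpha>\<close> makes the last constraint \<open>\<gamma> < 1 - \<alpha>\<close> strict.\<close>
    define \<gamma> where "\<gamma> = min \<alpha> (min (2 * \<beta>) ((1 - \<alpha>) / 2))"
    have \<gamma>: "0 < \<gamma>" "\<gamma> \<le> \<alpha>" "\<gamma> \<le> 2 * \<beta>" using params by (auto simp: \<gamma>_def)
    have "\<gamma> \<le> (1 - \<alpha>) / 2" unfolding \<gamma>_def by (rule min.coboundedI2[OF min.cobounded2])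
    then have "\<alpha> + \<gamma> < 1" using params(4) by argo
    then obtain K where K: "\<And>T. avg T \<le> K * (real T + 1) powr (-\<gamma>)" using rate[OF \<gamma>] by blast
    have "filterlim (\<lambda>T. real T + 1) at_top sequentially"
      by (rule filterlim_at_top_mono[OF filterlim_real_sequentially]) simp
    then have "(\<lambda>T. (real T + 1) powr (-\<gamma>)) \<longlonglongrightarrow> 0" using \<gamma>(1) by (intro tendsto_neg_powr) auto
    then have "(\<lambda>T. K * (real T + 1) powr (-\<gamma>)) \<longlonglongrightarrow> 0" by (rule tendsto_mult_right_zero)
    then show ?thesis
      by (rule real_tendsto_sandwich[rotated 3]) (auto simp: avg_nonneg K)
  qed
  moreover have "avg \<in> O(\<lambda>T. real T powr (-(1 / 2 - \<epsilon>)))"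
    if "\<alpha> = 1 / 2" "\<beta> = 1 / 4" "0 < \<epsilon>" "\<epsilon> < 1 / 2" for \<epsilon>
  proof -
    let ?\<gamma> = "1 / 2 - \<epsilon>"
    have "\<exists>K. \<forall>T. avg T \<le> K * (real T + 1) powr (-?\<gamma>)"
      by (rule rate) (use that in \<open>auto\<close>)
    then obtain K where K: "\<And>T. avg T \<le> K * (real T + 1) powr (-?\<gamma>)" by blast
    show ?thesis
    proof (rule bigoI)
      have "norm (avg T) \<le> \<bar>K\<bar> * norm (real T powr (-?\<gamma>))" if "1 \<le> T" for T
      proof -
        have "avg T \<le> \<bar>K\<bar> * (real T + 1) powr (-?\<gamma>)"
          using K[of T] by (rule order_trans) (intro mult_right_mono, auto)
        also have "\<dots> \<le> \<bar>K\<bar> * real T powr (-?\<gamma>)"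
          using that \<open>\<epsilon> < 1 / 2\<close> by (intro mult_left_mono powr_mono2') auto
        finally show ?thesis using avg_nonneg[of T] by simp
      qed
      then show "\<forall>\<^sub>F T in sequentially. norm (avg T) \<le> \<bar>K\<bar> * norm (real T powr (-?\<gamma>))"
        unfolding eventually_sequentially by blast
    qed
  qed
  ultimately show ?thesis unfolding avg_def by blast
qed

end
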